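(* Let $K$ be an algebraically closed field, $m\geq 4$, $\Gamma\in\mathbb{S}(m)$, $\operatorname{ind}(\Gamma)=\{\nu_1,\ldots,\nu_s\}$, and let $n\in\mathbb{O}(m,\Gamma)$. 1. The set $\mathcal{A}(m,\Gamma)^{C_n}$ of fixed points of the group $C_n=\langle t_{\lambda_n}\rangle\subseteq\mathbb{T}$ (where $\lambda_n$ is a primitive $n$-th root of unity) is a non-empty closed subvariety of the affine algebraic variety $\mathcal{A}(m,\Gamma)$, the defining equations of which are $\lambda_{\nu_i,j}=0$ for all $i=1,\ldots,s$ and $j\in C\Gamma(\nu_i)$ such that $n\nmid j-\nu_i$. The set $\mathcal{A}(m,\Gamma)^{C_n}$ contains precisely all the algebras $A$ in $\mathcal{A}(m,\Gamma)$ with $C_n\subseteq\operatorname{Aut}_K(A)$. 2. The set $\mathcal{A}(m,\Gamma)^{C_n}/\mathbb{T}$ is a set of isomorphism classes of algebras $A$ in $\mathbb{A}(m,\Gamma)$ with $C_n\subseteq\operatorname{Aut}_K(A)$. If $n\mid n'$ then $\mathcal{A}(m,\Gamma)^{C_n}/\mathbb{T}\supseteq\mathcal{A}(m,\Gamma)^{C_{n'}}/\mathbb{T}$. 3. The set $\mathcal{A}(m,\Gamma)^{C_n}/\mathbb{T}\setminus\bigcup_{n\neq l\in\mathbb{O}(m,\Gamma),\,n\mid l}\mathcal{A}(m,\Gamma)^{C_l}/\mathbb{T}$ is a set of isomorphism classes of algebras $A$ in $\mathbb{A}(m,\Gamma)$ with $C_n=\operatorname{Aut}_K(A)$. 4.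 The set $\mathcal{A}(m,\Gamma)/\mathbb{T}\setminus\Big(\{A_{\rm mon}(\Gamma)\}\cup\bigcup_{1\neq l\in\mathbb{O}(m,\Gamma)}\mathcal{A}(m,\Gamma)^{C_l}/\mathbb{T}\Big)$ is a set of isomorphism classes of algebras $A$ in $\mathbb{A}(m,\Gamma)$ with $\operatorname{Aut}_K(A)=\{e\}$. It is an open set of the algebraic variety $\mathcal{A}(m,\Gamma)$. 5. $\mathcal{A}(m,\Gamma)^{\mathbb{T}}=\{A_{\rm mon}(\Gamma)\}$.
   Context: $\mathbb{S}(m)$ is the set consisting of the empty set and of all non-empty subsets $\Gamma\subseteq\{2,\ldots,m-2\}$ such that $\Gamma+\Gamma\subseteq\Gamma\cup[m,\infty)$. An element of $\Gamma$ is decomposable if it is a sum of two elements of $\Gamma$; $\operatorname{ind}(\Gamma)=\{\nu_1<\cdots<\nu_s\}$ is the set of elements of $\Gamma$ that are not decomposable. $C\Gamma(k):=\{\delta\mid\delta\notin\Gamma,k<\delta\leq m-1\}$. $\mathcal{A}(m)$ is the set of all $K$-subalgebras $A$ of $K[x]$ such that $x^mK[x]\subset A$ and $x^{m-1}\notin A$. For $A\in\mathcal{A}(m)$, $\Gamma_A\in\mathbb{S}(m)$ is the set of integers $\gamma$ with $1\leq\gamma\leq m-1$ such that $A$ contains an element of the form $x^\gamma+\sum_{j>\gamma}\lambda_jx^j$. $\mathcal{A}(m,\Gamma):=\{A\in\mathcal{A}(m)\mid\Gamma_A=\Gamma\}$. $A_{\rm mon}(\Gamma):=K\oplus\bigoplus_{\gamma\in\Gamma}Kx^\gamma\oplus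 x^mK[x]$ is the monomial algebra in $\mathcal{A}(m,\Gamma)$. For $A\in\mathcal{A}(m,\Gamma)$, $\overline{A}:=A/x^mK[x]\subseteq K[x]/x^mK[x]$ has a unique $K$-basis $\{1,f_\gamma\mid\gamma\in\Gamma\}$ (the canonical basis) with $f_\gamma=x^\gamma+\sum_{\delta\in C\Gamma(\gamma)}\lambda_{\gamma,\delta}x^\delta$, $\lambda_{\gamma,\delta}\in K$. The coefficients $\lambda_{\nu_i,j}$ ($i=1,\ldots,s$, $j\in C\Gamma(\nu_i)$) of $f_{\nu_1},\ldots,f_{\nu_s}$ uniquely determine $A$; via them $\mathcal{A}(m,\Gamma)$ is identified with a Zariski closed subset of affine space of dimension $\sum_i|C\Gamma(\nu_i)|$, and this is its structure of affine algebraic variety. $\mathbb{T}=\{t_\lambda\mid\lambda\in K^\times\}$, $t_\lambda$ being the automorphism $x\mapsto\lambda x$ of $K[x]$; $\mathbb{T}$ acts on $\mathcal{A}(m,\Gamma)$ by $(t_\lambda,A)\mapsto t_\lambda(A)$. Two algebras in $\mathcal{A}(m,\Gamma)$ are isomorphic iff they lie in the same $\mathbb{T}$-orbit, so $\mathbb{A}(m,\Gamma):=\mathcal{A}(m,\Gamma)/\mathbb{T}$ is the set of isomorphism classes of algebras in $\mathcal{A}(m,\Gamma)$. $\operatorname{Aut}_K(A)$, the group of $K$-algebra automorphisms of $A$, is identified with $\{t_\lambda\in\mathbb{T}\mid t_\lambda(A)=A\}$. $\mathbb{O}(m,\Gamma):=\{|\operatorname{Aut}_K(A)|\ :\ A\in\mathcal{A}(m,\Gamma),\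 |\operatorname{Aut}_K(A)|<\infty\}$. For $n\geq 1$ (not divisible by $\operatorname{char}(K)$ if this is positive) $C_n=\langle t_{\lambda_n}\rangle$, where $\lambda_n$ is a primitive $n$-th root of unity in $K$, is the unique subgroup of order $n$ of $\mathbb{T}$.
   Formalization: In part 3 the class of A_mon(Γ) is also removed: for n maximal in O(m,Γ) under divisibility the union is empty and A_mon(Γ), whose automorphism group T is infinite, would remain in the set, so the claim as written fails. *)

theory Defs
  imports
    "HOL-Analysis.Abstract_Topology"
    "HOL-Computational_Algebra.Computational_Algebra"
begin

section \<open>Gap data\<close>

definition SS :: "nat \<Rightarrow> nat set set" where
  "SS m = {\<Gamma>. \<Gamma> \<subseteq> {2..m - 2} \<and> (\<forall>a\<in>\<Gamma>. \<forall>b\<in>\<Gamma>. a + b \<in> \<Gamma> \<or> m \<le> a + b)}"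

definition ind :: "nat set \<Rightarrow> nat set" where
  "ind \<Gamma> = {\<nu> \<in> \<Gamma>. \<not> (\<exists>a\<in>\<Gamma>. \<exists>b\<in>\<Gamma>. \<nu> = a + b)}"

definition CC :: "nat \<Rightarrow> nat set \<Rightarrow> nat \<Rightarrow> nat set" where
  "CC m \<Gamma> k = {\<delta>. \<delta> \<notin> \<Gamma> \<and> k < \<delta> \<and> \<delta> \<le> m - 1}"

section \<open>Subalgebras of the polynomial ring in one variable\<close>

definition subalgebra :: "'a::field poly set \<Rightarrow> bool" where
  "subalgebra A \<longleftrightarrow> 1 \<in> A \<and>
     (\<forall>p\<in>A. \<forall>q\<in>A. p + q \<in> A \<and> p * q \<in> A) \<and> (\<forall>c. \<forall>p\<in>A. smult c p \<in> A)"

definition AAm :: "nat \<Rightarrow> 'a::field poly set set" where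
  "AAm m = {A. subalgebra A \<and> (\<forall>q. monom 1 m * q \<in> A) \<and> monom 1 (m - 1) \<notin> A}"

definition Gam :: "nat \<Rightarrow> 'a::field poly set \<Rightarrow> nat set" where
  "Gam m A = {\<gamma>. 1 \<le> \<gamma> \<and> \<gamma> \<le> m - 1 \<and> (\<exists>f\<in>A. coeff f \<gamma> = 1 \<and> (\<forall>j<\<gamma>. coeff f j = 0))}"

definition AA :: "nat \<Rightarrow> nat set \<Rightarrow> 'a::field poly set set" where
  "AA m \<Gamma> = {A \<in> AAm m. Gam m A = \<Gamma>}"

definition Amon :: "nat \<Rightarrow> nat set \<Rightarrow> 'a::field poly set" where
  "Amon m \<Gamma> = {[:c:] + (\<Sum>\<gamma>\<in>\<Gamma>. monom (a \<gamma>) \<gamma>) + monom 1 m * q | c a q. True}"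

section \<open>The canonical basis and the variety structure\<close>

text \<open>
  Classes modulo \<open>x^m K[x]\<close> are represented by polynomials of degree less than \<open>m\<close>; since
  \<open>A\<close> contains \<open>x^m K[x]\<close>, such a polynomial lies in \<open>A\<close> iff its class lies in
  \<open>A / x^m K[x]\<close>. The predicate \<open>canon_form\<close> says that \<open>f\<close> has the shape
  \<open>x^\<gamma> + (a combination of the x^\<delta> with \<delta> in CC m \<Gamma> \<gamma>)\<close>.
\<close>

definition canon_form :: "nat \<Rightarrow> nat set \<Rightarrow> nat \<Rightarrow> 'a::field poly \<Rightarrow> bool" where
  "canon_form m \<Gamma> \<gamma> f \<longleftrightarrow> (\<exists>l. f = monom 1 \<gamma> + (\<Sum>\<delta>\<in>CC m \<Gamma> \<gamma>. monom (l \<delta>) \<delta>))"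

definition canon :: "nat \<Rightarrow> nat set \<Rightarrow> 'a::field poly set \<Rightarrow> nat \<Rightarrow> 'a poly" where
  "canon m \<Gamma> A \<gamma> = (THE f. f \<in> A \<and> canon_form m \<Gamma> \<gamma> f)"

lemma finite_CC [simp]: "finite (CC m \<Gamma> k)"
  by (rule finite_subset[of _ "{..m}"]) (auto simp: CC_def)

lemma canon_form_iff:
  "canon_form m \<Gamma> \<gamma> f \<longleftrightarrow> coeff f \<gamma> = 1 \<and> (\<forall>j. j \<noteq> \<gamma> \<longrightarrow> j \<notin> CC m \<Gamma> \<gamma> \<longrightarrow> coeff f j = 0)"
proof
  assume "canon_form m \<Gamma> \<gamma> f"
  then obtain l where l: "f = monom 1 \<gamma> + (\<Sum>\<delta>\<in>CC m \<Gamma> \<gamma>. monom (l \<delta>) \<delta>)"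
    by (auto simp: canon_form_def)
  have "coeff f j = (if j = \<gamma> then 1 else 0) + (if j \<in> CC m \<Gamma> \<gamma> then l j else 0)" for j
    by (auto simp: l coeff_sum)
  moreover have "\<gamma> \<notin> CC m \<Gamma> \<gamma>" by (auto simp: CC_def)
  ultimately show "coeff f \<gamma> = 1 \<and> (\<forall>j. j \<noteq> \<gamma> \<longrightarrow> j \<notin> CC m \<Gamma> \<gamma> \<longrightarrow> coeff f j = 0)" by simp
next
  assume r: "coeff f \<gamma> = 1 \<and> (\<forall>j. j \<noteq> \<gamma> \<longrightarrow> j \<notin> CC m \<Gamma> \<gamma> \<longrightarrow> coeff f j = 0)"
  have g: "\<gamma> \<notin> CC m \<Gamma> \<gamma>" by (auto simp: CC_def)
  have "f = monom 1 \<gamma> + (\<Sum>\<delta>\<in>CC m \<Gamma> \<gamma>. monom (coeff f \<delta>) \<delta>)"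
    using r g by (intro poly_eqI) (auto simp: coeff_sum)
  then show "canon_form m \<Gamma> \<gamma> f" unfolding canon_form_def by blast
qed

lemma canon_exists_unique:
  assumes A: "A \<in> AA m \<Gamma>" and \<gamma>: "\<gamma> \<in> \<Gamma>"
  shows "\<exists>!f. f \<in> A \<and> canon_form m \<Gamma> \<gamma> f"
proof -
  have add: "\<And>p q. p \<in> A \<Longrightarrow> q \<in> A \<Longrightarrow> p + q \<in> A"
    and sm: "\<And>c p. p \<in> A \<Longrightarrow> smult c p \<in> A"
    and cond: "\<And>q. monom 1 m * q \<in> A" and G: "Gam m A = \<Gamma>"
    using A by (auto simp: AA_def AAm_def subalgebra_def)
  have dif: "p - q \<in> A" if "p \<in> A" "q \<in> A" for p q
    using add[OF that(1) sm[OF that(2), of "-1"]] by simp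
  have ex: "\<exists>f\<in>A. coeff f \<gamma> = 1 \<and> (\<forall>j<\<gamma>. coeff f j = 0) \<and>
      (\<forall>j\<in>\<Gamma>. \<gamma> < j \<longrightarrow> j < k \<longrightarrow> coeff f j = 0)" for k
  proof (induction k)
    case 0
    from \<gamma> G show ?case by (auto simp: Gam_def)
  next
    case (Suc k)
    then obtain f where f: "f \<in> A" "coeff f \<gamma> = 1" "\<forall>j<\<gamma>. coeff f j = 0"
      "\<forall>j\<in>\<Gamma>. \<gamma> < j \<longrightarrow> j < k \<longrightarrow> coeff f j = 0" by blast
    show ?case
    proof (cases "k \<in> \<Gamma> \<and> \<gamma> < k")
      case True
      then obtain g where g: "g \<in> A" "coeff g k = 1" "\<forall>j<k. coeff g j = 0"
        using G by (auto simp: Gam_def)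
      have "f - smult (coeff f k) g \<in> A" using f g dif sm by blast
      then show ?thesis
        using f g True by (intro bexI[of _ "f - smult (coeff f k) g"]) (auto simp: less_Suc_eq)
    next
      case False
      then show ?thesis using f by (intro bexI[of _ f]) (auto simp: less_Suc_eq)
    qed
  qed
  from ex[of m] obtain f where f: "f \<in> A" "coeff f \<gamma> = 1" "\<forall>j<\<gamma>. coeff f j = 0"
      "\<forall>j\<in>\<Gamma>. \<gamma> < j \<longrightarrow> j < m \<longrightarrow> coeff f j = 0" by blast
  have gm: "\<gamma> < m" using \<gamma> G by (auto simp: Gam_def)
  define h where "h = f - monom 1 m * poly_shift m f"
  have ch: "coeff h j = (if j < m then coeff f j else 0)" for j
    by (auto simp: h_def coeff_monom_mult coeff_poly_shift)
  have hA: "h \<in> A" using f cond dif by (auto simp: h_def)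
  moreover have "canon_form m \<Gamma> \<gamma> h"
    unfolding canon_form_iff ch using f gm by (auto simp: CC_def)
  moreover have "f = g" if fg: "f \<in> A" "g \<in> A" "canon_form m \<Gamma> \<gamma> f" "canon_form m \<Gamma> \<gamma> g"
    for f g
  proof (rule ccontr)
    assume "f \<noteq> g"
    then have "\<exists>j. coeff (f - g) j \<noteq> 0" by (auto simp: poly_eq_iff)
    then obtain j where j: "coeff (f - g) j \<noteq> 0" "\<forall>i<j. coeff (f - g) i = 0"
      using exists_least_iff[of "\<lambda>j. coeff (f - g) j \<noteq> 0"] by blast
    have jC: "j \<in> CC m \<Gamma> \<gamma>"
      using j(1) fg(3,4) unfolding canon_form_iff coeff_diff by (metis diff_self)
    have "smult (inverse (coeff (f - g) j)) (f - g) \<in> A" using fg dif sm by blast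
    then have "j \<in> Gam m A"
      using j jC unfolding Gam_def
      by (intro CollectI conjI bexI[of _ "smult (inverse (coeff (f - g) j)) (f - g)"])
         (auto simp: CC_def)
    then show False using jC G by (auto simp: CC_def)
  qed
  ultimately show ?thesis by blast
qed

definition coord :: "nat \<Rightarrow> nat set \<Rightarrow> 'a::field poly set \<Rightarrow> nat \<Rightarrow> nat \<Rightarrow> 'a" where
  "coord m \<Gamma> A \<nu> j = coeff (canon m \<Gamma> A \<nu>) j"

text \<open>
  The affine space of dimension \<open>card I\<close> is the set of extensional functions on a finite index
  set \<open>I\<close>.
\<close>

inductive_set polyfuns :: "'i set \<Rightarrow> (('i \<Rightarrow> 'a::field) \<Rightarrow> 'a) set" for I where
  const: "(\<lambda>v. c) \<in> polyfuns I"
| var: "i \<in> I \<Longrightarrow> (\<lambda>v. v i) \<in> polyfuns I"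
| add: "p \<in> polyfuns I \<Longrightarrow> q \<in> polyfuns I \<Longrightarrow> (\<lambda>v. p v + q v) \<in> polyfuns I"
| mult: "p \<in> polyfuns I \<Longrightarrow> q \<in> polyfuns I \<Longrightarrow> (\<lambda>v. p v * q v) \<in> polyfuns I"

definition zero_locus :: "'i set \<Rightarrow> (('i \<Rightarrow> 'a::field) \<Rightarrow> 'a) set \<Rightarrow> ('i \<Rightarrow> 'a) set" where
  "zero_locus I P = {v \<in> I \<rightarrow>\<^sub>E UNIV. \<forall>p\<in>P. p v = 0}"

definition zariski :: "'i set \<Rightarrow> ('i \<Rightarrow> 'a::field) topology" where
  "zariski I = topology (\<lambda>U. \<exists>P \<subseteq> polyfuns I. U = (I \<rightarrow>\<^sub>E UNIV) - zero_locus I P)"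

lemma openin_zariski:
  "openin (zariski I) U \<longleftrightarrow>
     (\<exists>P \<subseteq> polyfuns I. U = (I \<rightarrow>\<^sub>E (UNIV :: 'a::field set)) - zero_locus I P)"
proof -
  let ?E = "I \<rightarrow>\<^sub>E (UNIV :: 'a set)"
  have "istopology (\<lambda>U. \<exists>P \<subseteq> polyfuns I. U = ?E - zero_locus I P)"
    unfolding istopology_def
  proof (intro conjI allI impI)
    fix S T assume "\<exists>P \<subseteq> polyfuns I. S = ?E - zero_locus I P"
      and "\<exists>P \<subseteq> polyfuns I. T = ?E - zero_locus I P"
    then obtain P Q where P: "P \<subseteq> polyfuns I" "S = ?E - zero_locus I P"
      and Q: "Q \<subseteq> polyfuns I" "T = ?E - zero_locus I Q" by auto
    let ?R = "{\<lambda>v. p v * q v | p q. p \<in> P \<and> q \<in> Q}"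
    have "?R \<subseteq> polyfuns I" using P(1) Q(1) by (auto intro!: polyfuns.mult)
    moreover have "S \<inter> T = ?E - zero_locus I ?R"
      unfolding P(2) Q(2) zero_locus_def by fastforce
    ultimately show "\<exists>P \<subseteq> polyfuns I. S \<inter> T = ?E - zero_locus I P" by blast
  next
    fix \<K> assume "\<forall>K\<in>\<K>. \<exists>P \<subseteq> polyfuns I. K = ?E - zero_locus I P"
    then obtain F where F: "\<And>K. K \<in> \<K> \<Longrightarrow> F K \<subseteq> polyfuns I \<and> K = ?E - zero_locus I (F K)"
      by metis
    have "(\<Union>K\<in>\<K>. F K) \<subseteq> polyfuns I" using F by blast
    moreover have "\<Union>\<K> = (\<Union>K\<in>\<K>. ?E - zero_locus I (F K))" using F by auto
    moreover have "\<dots> = ?E - zero_locus I (\<Union>K\<in>\<K>. F K)"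
      unfolding zero_locus_def by auto
    ultimately show "\<exists>P \<subseteq> polyfuns I. \<Union>\<K> = ?E - zero_locus I P" by metis
  qed
  then show ?thesis unfolding zariski_def by (simp add: topology_inverse')
qed

definition coord_index :: "nat \<Rightarrow> nat set \<Rightarrow> (nat \<times> nat) set" where
  "coord_index m \<Gamma> = (SIGMA \<nu>:ind \<Gamma>. CC m \<Gamma> \<nu>)"

definition coords :: "nat \<Rightarrow> nat set \<Rightarrow> 'a::field poly set \<Rightarrow> nat \<times> nat \<Rightarrow> 'a" where
  "coords m \<Gamma> A = restrict (\<lambda>(\<nu>, j). coord m \<Gamma> A \<nu> j) (coord_index m \<Gamma>)"

text \<open>
  The Zariski topology of the variety \<open>AA m \<Gamma>\<close>: the topology induced from affine space along
  the identification of an algebra with its vector of coordinates.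
\<close>

definition variety :: "nat \<Rightarrow> nat set \<Rightarrow> 'a::field poly set topology" where
  "variety m \<Gamma> = pullback_topology (AA m \<Gamma>) (coords m \<Gamma>) (zariski (coord_index m \<Gamma>))"

section \<open>Isomorphisms and automorphisms\<close>

definition alg_iso :: "'a::field poly set \<Rightarrow> 'a poly set \<Rightarrow> ('a poly \<Rightarrow> 'a poly) \<Rightarrow> bool" where
  "alg_iso A B f \<longleftrightarrow> bij_betw f A B \<and> f 1 = 1 \<and>
     (\<forall>p\<in>A. \<forall>q\<in>A. f (p + q) = f p + f q \<and> f (p * q) = f p * f q) \<and>
     (\<forall>c. \<forall>p\<in>A. f (smult c p) = smult c (f p))"

text \<open>Automorphisms are extensional on \<open>A\<close>, so that \<open>card (Aut A)\<close> is the group order.\<close>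

definition Aut :: "'a::field poly set \<Rightarrow> ('a poly \<Rightarrow> 'a poly) set" where
  "Aut A = {f \<in> extensional A. alg_iso A A f}"

definition aut_orders :: "'a::field itself \<Rightarrow> nat \<Rightarrow> nat set \<Rightarrow> nat set" where
  "aut_orders _ m \<Gamma> = {card (Aut A) | A :: 'a poly set. A \<in> AA m \<Gamma> \<and> finite (Aut A)}"

definition iso_class :: "nat \<Rightarrow> nat set \<Rightarrow> 'a::field poly set \<Rightarrow> 'a poly set set" where
  "iso_class m \<Gamma> A = {B \<in> AA m \<Gamma>. \<exists>f. alg_iso A B f}"

section \<open>The torus action\<close>

definition tt :: "'a::field \<Rightarrow> 'a poly \<Rightarrow> 'a poly" where
  "tt c p = pcompose p [:0, c:]"

definition TT :: "('a::field poly \<Rightarrow> 'a poly) set" where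
  "TT = {tt c | c. c \<noteq> 0}"

definition primitive_root :: "nat \<Rightarrow> 'a::field \<Rightarrow> bool" where
  "primitive_root n z \<longleftrightarrow> 1 \<le> n \<and> z ^ n = 1 \<and> (\<forall>k. 1 \<le> k \<and> k < n \<longrightarrow> z ^ k \<noteq> 1)"

text \<open>
  A chosen primitive \<open>n\<close>-th root of unity; over an algebraically closed field one exists iff
  \<open>n \<ge> 1\<close> and the characteristic does not divide \<open>n\<close>. The group it generates does not depend
  on the choice.
\<close>

definition unity_root :: "nat \<Rightarrow> 'a::field" where
  "unity_root n = (SOME z. primitive_root n z)"

definition Cyc :: "nat \<Rightarrow> ('a::field poly \<Rightarrow> 'a poly) set" where
  "Cyc n = {tt (unity_root n powi k) | k. True}"

text \<open>
  Elements of the torus that stabilise \<open>A\<close> are regarded as automorphisms of \<open>A\<close> by restriction.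
\<close>

definition on_alg :: "('a::field poly \<Rightarrow> 'a poly) set \<Rightarrow> 'a poly set \<Rightarrow> ('a poly \<Rightarrow> 'a poly) set" where
  "on_alg G A = (\<lambda>g. restrict g A) ` G"

definition fixed :: "nat \<Rightarrow> nat set \<Rightarrow> ('a::field poly \<Rightarrow> 'a poly) set \<Rightarrow> 'a poly set set" where
  "fixed m \<Gamma> G = {A \<in> AA m \<Gamma>. \<forall>g\<in>G. g ` A = A}"

definition torus_orbit :: "'a::field poly set \<Rightarrow> 'a poly set set" where
  "torus_orbit A = {g ` A | g. g \<in> TT}"

definition quot :: "'a::field poly set set \<Rightarrow> 'a poly set set set" where
  "quot X = torus_orbit ` X"

end

theory Submission
  imports Defs
begin

text \<open>
  An isomorphism between algebras in \<open>AAm m\<close> extends to the fraction field \<open>K(x)\<close> and preserves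
  conductors, which forces it to be some \<open>t_c\<close>; hence \<open>Aut A\<close> is the stabiliser of \<open>A\<close> in the
  torus and isomorphism classes are torus orbits. Since \<open>t_c\<close> multiplies the coordinate
  \<open>\<lambda>_(\<nu>,j)\<close> by \<open>c^(j - \<nu>)\<close>, the stabiliser of a non-monomial algebra consists of the \<open>d\<close>-th
  roots of unity, \<open>d\<close> being the gcd of the \<open>j - \<nu>\<close> with \<open>\<lambda>_(\<nu>,j) \<noteq> 0\<close>; removing the power of
  the characteristic from \<open>d\<close> gives a cyclic group of order at most \<open>m\<close>. All claims then reduce to
  divisibility between orders of groups of roots of unity.
\<close>

section \<open>Roots of unity\<close>

text \<open>Three points shape the argument. The monomial algebra lies in every fixed set of a
  \<open>Cyc n\<close>, but its automorphism group is the whole torus. If no proper multiple of n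
  lies in \<open>aut_orders\<close>, no larger fixed set removes it; hence its class is subtracted
  explicitly in item 3, as in item 4. In characteristic p the group {c. c^n = 1} determines n only
  if p does not divide n, since {c. c^p = 1} is trivial; this is why the power of p has to leave the
  gcd before orders and divisibility can be compared. Finally, the bound m on the orders makes
  \<open>aut_orders\<close> finite, so that item 4 removes only a finite union of closed sets, which
  gives openness.\<close>

lemma power_gcd_eq_1:
  fixes z :: "'a::comm_semiring_1"
  assumes "z ^ a = 1" "z ^ b = 1"
  shows "z ^ gcd a b = 1"
proof (cases "a = 0")
  case False
  then obtain x y where xy: "a * x = b * y + gcd a b"
    using bezout_nat by blast
  have "1 = z ^ (a * x)" using assms by (simp add: power_mult)
  also have "\<dots> = z ^ (b * y) * z ^ gcd a b" by (simp add: xy power_add)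
  also have "\<dots> = z ^ gcd a b" using assms by (simp add: power_mult)
  finally show ?thesis by simp
qed (use assms in simp)

lemma power_Gcd_eq_1_iff:
  fixes z :: "'a::comm_semiring_1"
  assumes "finite S"
  shows "z ^ Gcd S = 1 \<longleftrightarrow> (\<forall>k\<in>S. z ^ k = 1)"
proof
  assume z: "z ^ Gcd S = 1"
  show "\<forall>k\<in>S. z ^ k = 1"
  proof
    fix k assume "k \<in> S"
    then have "Gcd S dvd k" by simp
    then obtain q where "k = Gcd S * q" by (rule dvdE)
    with z show "z ^ k = 1" by (metis power_mult power_one)
  qed
next
  assume "\<forall>k\<in>S. z ^ k = 1"
  with assms show "z ^ Gcd S = 1"
    by (induction S rule: finite_induct) (simp_all add: power_gcd_eq_1)
qed

text \<open>The working form of primitivity. If z^k = 1, then gcd k n is a positive exponent of the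
  same kind and at most n, so minimality makes it equal to n.\<close>

lemma primitive_root_iff:
  "primitive_root n z \<longleftrightarrow> 1 \<le> n \<and> (\<forall>k. z ^ k = 1 \<longleftrightarrow> n dvd k)"
proof
  assume z: "primitive_root n z"
  then have n: "1 \<le> n" "z ^ n = 1" and min: "\<And>k. 1 \<le> k \<Longrightarrow> k < n \<Longrightarrow> z ^ k \<noteq> 1"
    by (auto simp: primitive_root_def)
  have "n dvd k" if "z ^ k = 1" for k
  proof -
    have "z ^ gcd k n = 1" using that n(2) by (rule power_gcd_eq_1)
    moreover have "gcd k n \<le> n" "1 \<le> gcd k n"
      using n(1) by (auto simp: gcd_le2_nat Suc_le_eq)
    ultimately have "gcd k n = n" using min le_neq_implies_less by blast
    then show ?thesis by (metis gcd_dvd1)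
  qed
  moreover have "z ^ k = 1" if "n dvd k" for k
    using that n(2) by (auto simp: power_mult elim!: dvdE)
  ultimately show "1 \<le> n \<and> (\<forall>k. z ^ k = 1 \<longleftrightarrow> n dvd k)" using n by blast
qed (auto simp: primitive_root_def dvd_imp_le dest!: nat_dvd_not_less[rotated])

text \<open>A root of 1 + X + ... + X^(q-1) works: it is a q-th root of unity, and it is not 1
  because the value at 1 is q, which is nonzero in the field.\<close>

lemma primitive_root_prime_exists:
  assumes q: "prime q" and char: "\<not> CHAR('a) dvd q"
  shows "\<exists>z::'a::alg_closed_field. primitive_root q z"
proof -
  have q2: "2 \<le> q" using q by (rule prime_ge_2_nat)
  then obtain z :: 'a where z: "(\<Sum>k\<le>q - 1. 1 * z ^ k) = 0"
    using alg_closed[of "q - 1" "\<lambda>_. 1 :: 'a"] by auto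
  have eq: "{..q - 1} = {..<q}" using q2 by auto
  have "z ^ q - 1 = (z - 1) * (\<Sum>k<q. z ^ k)" by (rule power_diff_1_eq)
  then have zq: "z ^ q = 1" using z unfolding eq by simp
  have z1: "z \<noteq> 1" using z char unfolding eq by (auto simp: of_nat_eq_0_iff_char_dvd)
  have "z ^ k \<noteq> 1" if "1 \<le> k" "k < q" for k
  proof
    assume "z ^ k = 1"
    then have "z ^ gcd k q = 1" using zq by (rule power_gcd_eq_1)
    moreover have "coprime k q"
      using that q by (metis coprime_commute nat_dvd_not_less not_one_le_zero neq0_conv prime_imp_coprime)
    ultimately show False using z1 by simp
  qed
  then show ?thesis using q2 zq by (auto simp: primitive_root_def)
qed

text \<open>Prime factors are adjoined one at a time. If q divides n, a q-th root of a primitive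
  n-th root has order q * n; otherwise its product with a primitive q-th root does.\<close>

lemma primitive_root_exists:
  assumes "1 \<le> n" and "\<not> CHAR('a) dvd n"
  shows "\<exists>z::'a::alg_closed_field. primitive_root n z"
  using assms
proof (induction n rule: prime_divisors_induct)
  case (unit n)
  then show ?case by (intro exI[of _ 1]) (auto simp: primitive_root_def)
next
  case (factor q n)
  then have n: "1 \<le> n" "\<not> CHAR('a) dvd n" "\<not> CHAR('a) dvd q" "1 \<le> q"
    by (auto simp: Suc_le_eq)
  then obtain z :: 'a where z: "\<And>k. z ^ k = 1 \<longleftrightarrow> n dvd k"
    using factor.IH by (auto simp: primitive_root_iff)
  show ?case
  proof (cases "q dvd n")
    case True
    then obtain n' where n': "n = q * n'" by (rule dvdE)
    obtain w where w: "w ^ q = z" using nth_root_exists[of q z] n by auto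
    have "w ^ k = 1 \<longleftrightarrow> q * n dvd k" for k
    proof
      assume wk: "w ^ k = 1"
      have "z ^ k = (w ^ k) ^ q" by (simp add: w[symmetric] mult.commute flip: power_mult)
      then have "n dvd k" using wk by (simp flip: z)
      then obtain j where j: "k = n * j" by (rule dvdE)
      \<comment> \<open>Since n = q * n', both sides are w^(n * j). So n divides n' * j, that is, q
        divides j.\<close>
      have "z ^ (n' * j) = w ^ k" by (simp add: w[symmetric] j n' mult.assoc flip: power_mult)
      then have "n dvd n' * j" using wk by (simp flip: z)
      then have "q dvd j" using n n' by (auto simp: mult.commute)
      then show "q * n dvd k" by (simp add: j mult.commute)
    next
      assume "q * n dvd k"
      then obtain j where "k = q * (n * j)" by (metis dvdE mult.assoc)
      then have "w ^ k = z ^ (n * j)" by (simp add: w power_mult)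
      then show "w ^ k = 1" by (simp add: z)
    qed
    then show ?thesis using factor.prems by (auto simp: primitive_root_iff)
  next
    case False
    then have co: "coprime q n" using factor.hyps by (simp add: prime_imp_coprime)
    obtain y :: 'a where y: "\<And>k. y ^ k = 1 \<longleftrightarrow> q dvd k"
      using primitive_root_prime_exists[OF factor.hyps n(3)] by (auto simp: primitive_root_iff)
    have "(z * y) ^ k = 1 \<longleftrightarrow> q * n dvd k" for k
    proof
      assume k: "(z * y) ^ k = 1"
      \<comment> \<open>Raising to the power q removes y, raising to the power n removes z; the two
        orders can then be treated separately.\<close>
      have "z ^ (k * q) * y ^ (k * q) = 1" "z ^ (k * n) * y ^ (k * n) = 1"
        using k by (simp_all add: power_mult flip: power_mult_distrib)
      moreover have "y ^ (k * q) = 1" "z ^ (k * n) = 1" by (simp_all add: y z)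
      ultimately have "n dvd k * q" "q dvd k * n" by (simp_all flip: y z)
      then show "q * n dvd k"
        using co by (simp add: coprime_dvd_mult_left_iff divides_mult coprime_commute)
    next
      assume "q * n dvd k"
      then show "(z * y) ^ k = 1"
        using y z by (metis dvd_mult_left dvd_mult_right mult_1 power_mult_distrib)
    qed
    then show ?thesis using factor.prems by (auto simp: primitive_root_iff)
  qed
qed simp

lemma finite_roots_of_unity:
  assumes "1 \<le> n"
  shows "finite {c :: 'a::field. c ^ n = 1}" and "card {c :: 'a. c ^ n = 1} \<le> n"
proof -
  let ?p = "monom 1 n - 1 :: 'a poly"
  have eq: "{c. c ^ n = 1} = {c. poly ?p c = 0}" by (simp add: poly_monom)
  have "coeff ?p n = 1" using assms by (simp add: coeff_1)
  then have p: "?p \<noteq> 0" by (metis coeff_0 zero_neq_one)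
  show "finite {c :: 'a. c ^ n = 1}" unfolding eq by (rule poly_roots_finite[OF p])
  have "degree ?p \<le> n" by (rule degree_le) (auto simp: coeff_1)
  then show "card {c :: 'a. c ^ n = 1} \<le> n"
    unfolding eq using card_poly_roots_bound[OF p] by linarith
qed

lemma
  fixes z :: "'a::field"
  assumes z: "primitive_root n z"
  shows roots_of_unity_eq: "{c. c ^ n = 1} = (\<lambda>k. z ^ k) ` {..<n}"
    and card_roots_of_unity: "card {c :: 'a. c ^ n = 1} = n"
proof -
  have n: "1 \<le> n" and zk: "\<And>k. z ^ k = 1 \<longleftrightarrow> n dvd k" using z by (auto simp: primitive_root_iff)
  have z0: "z \<noteq> 0" using zk[of n] n by (auto simp: power_0_left)
  have aux: "i = j" if "i \<le> j" "j < n" "z ^ i = z ^ j" for i j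
  proof -
    have "z ^ (j - i) = 1" using that z0 by (simp add: power_diff)
    with that show ?thesis by (auto simp: zk dest: dvd_imp_le)
  qed
  have "inj_on (\<lambda>k. z ^ k) {..<n}"
    by (rule inj_onI) (metis aux lessThan_iff nat_le_linear)
  then have c: "card ((\<lambda>k. z ^ k) ` {..<n}) = n" by (simp add: card_image)
  have sub: "(\<lambda>k. z ^ k) ` {..<n} \<subseteq> {c. c ^ n = 1}"
    by (auto simp: zk simp flip: power_mult)
  show eq: "{c. c ^ n = 1} = (\<lambda>k. z ^ k) ` {..<n}"
    using card_seteq[OF finite_roots_of_unity(1)[OF n] sub] c finite_roots_of_unity(2)[OF n, where 'a='a]
    by simp
  show "card {c :: 'a. c ^ n = 1} = n" using c eq by simp
qed

text \<open>The inclusion is tested on z alone. This translates inclusion of finite subgroups of the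
  torus into divisibility of their orders.\<close>

lemma roots_of_unity_dvd_iff:
  assumes "primitive_root n (z :: 'a::field)"
  shows "{c :: 'a. c ^ n = 1} \<subseteq> {c. c ^ l = 1} \<longleftrightarrow> n dvd l"
proof
  assume "{c :: 'a. c ^ n = 1} \<subseteq> {c. c ^ l = 1}"
  then have "z ^ l = 1" using assms by (auto simp: primitive_root_def)
  then show "n dvd l" using assms by (simp add: primitive_root_iff)
qed (auto elim!: dvdE simp: power_mult)

text \<open>If d = p^e * n with p the characteristic, Frobenius gives c^d - 1 = (c^n - 1)^(p^e), so
  the factor p^e contributes no further roots.\<close>

lemma roots_of_unity_prime_to_char:
  assumes d: "1 \<le> d"
  obtains n where "1 \<le> n" "n \<le> d" "\<not> CHAR('a::field) dvd n"
    "{c :: 'a. c ^ d = 1} = {c. c ^ n = 1}"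
proof (cases "CHAR('a) = 0")
  case True
  with d that[of d] show ?thesis by auto
next
  case False
  then have p: "prime CHAR('a)" by (simp add: prime_CHAR_semidom)
  have "d \<noteq> 0" "\<not> is_unit CHAR('a)" using d by auto
  then obtain n where n: "d = CHAR('a) ^ multiplicity CHAR('a) d * n" "\<not> CHAR('a) dvd n"
    using multiplicity_decompose' by blast
  define k where "k = CHAR('a) ^ multiplicity CHAR('a) d"
  have d': "d = k * n" "k > 0" using n(1) False by (simp_all add: k_def)
  have "c ^ n = 1" if "c ^ d = 1" for c :: 'a
  proof -
    have "1 = ((c ^ n - 1) + 1) ^ k" using that by (simp add: d' mult.commute flip: power_mult)
    also have "\<dots> = (c ^ n - 1) ^ k + 1"
      using freshmans_dream'[OF p k_def, of "c ^ n - 1" 1] by simp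
    finally show ?thesis by simp
  qed
  then have "{c :: 'a. c ^ d = 1} = {c. c ^ n = 1}" by (auto simp: d' mult.commute[of k] power_mult)
  moreover have "1 \<le> n" "n \<le> d" using d d' by (auto simp: Suc_le_eq)
  ultimately show ?thesis using that n(2) by blast
qed

lemma unity_root_primitive:
  assumes "1 \<le> n" and "\<not> CHAR('a) dvd n"
  shows "primitive_root n (unity_root n :: 'a::alg_closed_field)"
  unfolding unity_root_def by (rule someI_ex[OF primitive_root_exists[OF assms]])

text \<open>The integer powers of the root are n-th roots of unity, and its first n powers already
  exhaust these. From here on the choice made in \<open>unity_root\<close> disappears.\<close>

lemma Cyc_eq:
  assumes "primitive_root n (unity_root n :: 'a::field)"
  shows "(Cyc n :: ('a poly \<Rightarrow> 'a poly) set) = tt ` {c. c ^ n = 1}"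
proof -
  let ?z = "unity_root n :: 'a"
  have zn: "?z ^ n = 1" using assms by (simp add: primitive_root_def)
  have "range (\<lambda>k. ?z powi k) = {c. c ^ n = 1}"
  proof (intro equalityI subsetI)
    fix c :: 'a assume "c \<in> range (\<lambda>k. ?z powi k)"
    then obtain k where c: "c = ?z powi k" by blast
    have "c ^ n = ?z powi (k * int n)" unfolding c power_int_mult power_int_of_nat ..
    also have "\<dots> = (?z powi int n) powi k"
      unfolding mult.commute[of k] by (rule power_int_mult)
    finally show "c \<in> {c. c ^ n = 1}" using zn by (simp only: power_int_of_nat power_int_1_left mem_Collect_eq)
  next
    fix c :: 'a assume "c \<in> {c. c ^ n = 1}"
    then obtain k where "c = ?z powi int k" unfolding roots_of_unity_eq[OF assms] by auto
    then show "c \<in> range (\<lambda>k. ?z powi k)" by blast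
  qed
  moreover have "Cyc n = tt ` range (\<lambda>k. ?z powi k)" unfolding Cyc_def by fast
  ultimately show ?thesis by simp
qed

text \<open>Over a finite field, 1 plus the product of all X - a would be nonconstant and without a
  root.\<close>

lemma infinite_UNIV_alg_closed: "infinite (UNIV :: 'a::alg_closed_field set)"
proof
  assume fin: "finite (UNIV :: 'a set)"
  let ?p = "1 + (\<Prod>a\<in>UNIV. [:- a, 1 :: 'a:])"
  have dd: "degree (\<Prod>a\<in>UNIV. [:- a, 1 :: 'a:]) = card (UNIV :: 'a set)"
    by (subst degree_prod_eq_sum_degree) (auto)
  have "card (UNIV :: 'a set) > 0" using fin by (simp add: card_gt_0_iff)
  then have "degree ?p > 0" by (subst degree_add_eq_right) (auto simp: dd)
  then obtain x where "poly ?p x = 0" using alg_closed_imp_poly_has_root by blast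
  moreover have "poly (\<Prod>a\<in>UNIV. [:- a, 1 :: 'a:]) x = 0"
    using fin by (auto simp: poly_prod intro!: prod_zero)
  ultimately show False by simp
qed

section \<open>Isomorphisms are induced by the torus\<close>

lemma
  assumes "A \<in> AAm m"
  shows AAm_one: "1 \<in> A"
    and AAm_add: "p \<in> A \<Longrightarrow> q \<in> A \<Longrightarrow> p + q \<in> A"
    and AAm_mult: "p \<in> A \<Longrightarrow> q \<in> A \<Longrightarrow> p * q \<in> A"
    and AAm_smult: "p \<in> A \<Longrightarrow> smult c p \<in> A"
    and AAm_conductor: "monom 1 m * r \<in> A"
    and AAm_gap: "monom 1 (m - 1) \<notin> A"
  using assms by (auto simp: AAm_def subalgebra_def)

lemma AAm_diff: "A \<in> AAm m \<Longrightarrow> p \<in> A \<Longrightarrow> q \<in> A \<Longrightarrow> p - q \<in> A"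
  using AAm_add[of A m p "smult (- 1) q"] AAm_smult[of A m q "- 1"] by simp

lemma AAm_monom: "A \<in> AAm m \<Longrightarrow> m \<le> k \<Longrightarrow> monom 1 k * r \<in> A"
  using AAm_conductor[of A m "monom 1 (k - m) * r"] by (simp add: mult_monom flip: mult.assoc)

lemma AAm_power: "A \<in> AAm m \<Longrightarrow> p \<in> A \<Longrightarrow> p ^ k \<in> A"
  by (induction k) (auto simp: AAm_one AAm_mult)

lemma
  assumes "alg_iso A B f"
  shows alg_iso_bij: "bij_betw f A B"
    and alg_iso_one: "f 1 = 1"
    and alg_iso_add: "p \<in> A \<Longrightarrow> q \<in> A \<Longrightarrow> f (p + q) = f p + f q"
    and alg_iso_mult: "p \<in> A \<Longrightarrow> q \<in> A \<Longrightarrow> f (p * q) = f p * f q"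
    and alg_iso_smult: "p \<in> A \<Longrightarrow> f (smult c p) = smult c (f p)"
  using assms by (auto simp: alg_iso_def)

lemma alg_iso_inv:
  assumes A: "A \<in> AAm m" and f: "alg_iso A B f"
  shows "alg_iso B A (inv_into A f)"
proof -
  let ?g = "inv_into A f"
  have bij: "bij_betw ?g B A" using alg_iso_bij[OF f] by (rule bij_betw_inv_into)
  have g: "?g q \<in> A" "f (?g q) = q" if "q \<in> B" for q
    using bij_betw_apply[OF bij that] bij_betw_inv_into_right[OF alg_iso_bij[OF f] that] .
  have gf: "?g q = p" if "p \<in> A" "f p = q" for p q
    using bij_betw_inv_into_left[OF alg_iso_bij[OF f] that(1)] that(2) by simp
  have "?g 1 = 1" using A f by (intro gf) (auto simp: AAm_one alg_iso_one)
  moreover have "?g (p + q) = ?g p + ?g q" "?g (p * q) = ?g p * ?g q" if "p \<in> B" "q \<in> B" for p q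
    using that A f
    by (auto intro!: gf simp: g AAm_add AAm_mult alg_iso_add[OF f] alg_iso_mult[OF f])
  moreover have "?g (smult c p) = smult c (?g p)" if "p \<in> B" for c p
    using that A by (auto intro!: gf simp: g AAm_smult alg_iso_smult[OF f])
  ultimately show ?thesis using bij by (simp add: alg_iso_def)
qed

text \<open>The concrete form in which integral closedness enters. A nonconstant P has a linear
  factor; it divides Q^m, hence Q, and cancelling its m-th power lowers the degree of P.\<close>

lemma power_dvd_power_poly:
  fixes P Q :: "'a::alg_closed_field poly"
  assumes "0 < m" and "P \<noteq> 0" and "P ^ m dvd Q ^ m"
  shows "P dvd Q"
  using assms(2,3)
proof (induction "degree P" arbitrary: P Q rule: less_induct)
  case less
  show ?case
  proof (cases "degree P = 0")
    case True
    then show ?thesis using less.prems(1) by (simp add: is_unit_iff_degree unit_imp_dvd)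
  next
    case False
    then obtain a where "poly P a = 0" using alg_closed_imp_poly_has_root by blast
    then obtain P' where P': "P = [:- a, 1:] * P'" by (auto simp: poly_eq_0_iff_dvd elim: dvdE)
    have "[:- a, 1:] dvd P" unfolding P' by (rule dvd_triv_left)
    also have "P dvd P ^ m" using assms(1) by (simp add: dvd_power)
    finally have "[:- a, 1:] dvd P ^ m" .
    then have "[:- a, 1:] dvd Q ^ m" using less.prems(2) by (rule dvd_trans)
    then have "poly Q a = 0" using assms(1) by (simp flip: poly_eq_0_iff_dvd)
    then obtain Q' where Q': "Q = [:- a, 1:] * Q'" by (auto simp: poly_eq_0_iff_dvd elim: dvdE)
    have P'0: "P' \<noteq> 0" using less.prems(1) P' by auto
    have "degree P' < degree P" using P'0 unfolding P' by (subst degree_mult_eq) auto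
    moreover have "P' ^ m dvd Q' ^ m"
      using less.prems(2) unfolding P' Q' power_mult_distrib by (subst (asm) dvd_mult_cancel_left) auto
    ultimately have "P' dvd Q'" using less.hyps P'0 by blast
    then show ?thesis unfolding P' Q' by (rule mult_dvd_mono[OF dvd_refl])
  qed
qed

text \<open>
  In the fraction field, \<open>x = x^(m+1) / x^m\<close>, so \<open>f\<close> must substitute
  \<open>f (x^(m+1)) / f (x^m)\<close> for \<open>x\<close>. This fraction is a polynomial because its \<open>m\<close>-th power is
  \<open>f (x^m)\<close> and \<open>K[x]\<close> is integrally closed.
\<close>

lemma alg_iso_pcompose:
  fixes A B :: "'a::alg_closed_field poly set"
  assumes m: "0 < m" and A: "A \<in> AAm m" and f: "alg_iso A B f"
  obtains y where "\<And>g. g \<in> A \<Longrightarrow> f g = pcompose g y"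
proof -
  have inA: "monom 1 k \<in> A" "monom 1 k * r \<in> A" if "m \<le> k" for k r
    using AAm_monom[OF A that, of 1] AAm_monom[OF A that] by auto
  have zero: "0 \<in> A" "f 0 = 0"
    using AAm_smult[OF A AAm_one[OF A], of 0] alg_iso_smult[OF f AAm_one[OF A], of 0] by simp_all
  have pow: "f (p ^ k) = f p ^ k" if "p \<in> A" for p k
    using that by (induction k) (simp_all add: alg_iso_one[OF f] alg_iso_mult[OF f] AAm_power[OF A])
  define P Q where "P = f (monom 1 m)" and "Q = f (monom 1 (Suc m))"
  have P0: "P \<noteq> 0"
  proof
    assume "P = 0"
    then have "monom 1 m = (0 :: 'a poly)"
      using alg_iso_bij[OF f] inA(1)[of m] zero unfolding P_def bij_betw_def
      by (metis inj_onD order_refl)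
    then show False by simp
  qed
  have "Q ^ m = f (monom 1 (Suc m) ^ m)" unfolding Q_def by (simp add: pow inA)
  also have "monom 1 (Suc m) ^ m = (monom 1 m :: 'a poly) ^ Suc m"
    unfolding monom_power by (simp add: mult.commute)
  also have "f \<dots> = P ^ Suc m" unfolding P_def by (rule pow) (simp add: inA)
  finally have QP: "Q ^ m = P ^ m * P" by (simp add: mult.commute)
  then have "P dvd Q" using power_dvd_power_poly[OF m P0] by simp
  then obtain y where y: "Q = P * y" by (rule dvdE)
  have ym: "y ^ m = P" using QP P0 by (simp add: y power_mult_distrib)
  have monoms: "f (monom 1 (m + k)) = y ^ (m + k)" for k
  proof (induction k)
    case 0
    then show ?case by (simp add: ym P_def)
  next
    case (Suc k)
    have "f (monom 1 (m + Suc k)) * P = f (monom 1 (m + Suc k) * monom 1 m)"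
      unfolding P_def by (simp add: alg_iso_mult[OF f] inA)
    also have "\<dots> = f (monom 1 (m + k) * monom 1 (Suc m))" by (simp add: mult_monom add_ac)
    also have "\<dots> = f (monom 1 (m + k)) * Q"
      unfolding Q_def by (rule alg_iso_mult[OF f]) (simp_all add: inA)
    also have "\<dots> = y ^ (m + Suc k) * P" using Suc by (simp add: y mult_ac)
    finally show ?case using P0 by simp
  qed
  \<comment> \<open>The exponent k must vary: splitting off the constant coefficient of
    \<open>pCons a h\<close> leaves x^(k+1) * h.\<close>
  have cond: "f (monom 1 k * h) = y ^ k * pcompose h y" if "m \<le> k" for k h
    using that
  proof (induction h arbitrary: k)
    case 0
    then show ?case by (simp add: zero)
  next
    case (pCons a h)
    have "monom 1 k * pCons a h = smult a (monom 1 k) + monom 1 (Suc k) * h"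
      by (simp add: monom_Suc)
    then have "f (monom 1 k * pCons a h) = smult a (f (monom 1 k)) + f (monom 1 (Suc k) * h)"
      using pCons.prems by (simp add: alg_iso_add[OF f] alg_iso_smult[OF f] AAm_smult[OF A] inA)
    also have "f (monom 1 k) = y ^ k" using monoms[of "k - m"] pCons.prems by simp
    also have "f (monom 1 (Suc k) * h) = y ^ Suc k * pcompose h y"
      using pCons by simp
    finally show ?case by (simp add: pcompose_pCons algebra_simps)
  qed
  have "f g = pcompose g y" if "g \<in> A" for g
  proof -
    \<comment> \<open>Multiplication by x^m moves g into the conductor, where f is already known;
      cancelling P = y^m returns to g.\<close>
    have "P * f g = f (monom 1 m * g)" unfolding P_def using that by (simp add: alg_iso_mult[OF f] inA)
    also have "\<dots> = P * pcompose g y" by (simp add: cond ym)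
    finally show ?thesis using P0 by simp
  qed
  then show ?thesis using that by blast
qed

lemma pcompose_power: "pcompose (p ^ k) q = pcompose p q ^ k"
  by (induction k) (simp_all add: pcompose_mult pcompose_1)

lemma pcompose_monom: "pcompose (monom c k) y = smult c (y ^ k)"
  by (induction k) (simp_all add: monom_0 monom_Suc pcompose_pCons)

text \<open>x itself need not lie in A, but x^m and x^(m+1) do. With w = y(z) they give w^m = x^m
  and w^(m+1) = x^(m+1), hence w = x.\<close>

lemma pcompose_mutual_inverse:
  fixes y z :: "'a::field poly"
  assumes A: "A \<in> AAm m" and id: "\<And>g. g \<in> A \<Longrightarrow> pcompose (pcompose g y) z = g"
  shows "pcompose y z = [:0, 1:]"
proof -
  let ?w = "pcompose y z"
  have x: "[:0, 1:] ^ k = (monom 1 k :: 'a poly)" for k by (simp add: monom_altdef)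
  have w: "?w ^ k = [:0, 1:] ^ k" if "m \<le> k" for k
  proof -
    have "monom 1 k \<in> A" using AAm_monom[OF A that, of 1] by simp
    from id[OF this] show ?thesis by (simp add: pcompose_monom pcompose_power x)
  qed
  have "?w ^ m * ?w = ?w ^ m * [:0, 1:]" using w[of m] w[of "Suc m"] by (simp add: mult.commute)
  moreover have nz: "?w ^ m \<noteq> 0" unfolding w[OF order_refl] by simp
  ultimately show ?thesis using mult_left_cancel[OF nz] by blast
qed

text \<open>
  An isomorphism carries the conductor \<open>x^m K[x]\<close> to \<open>y^m K[x]\<close> with \<open>y\<close> linear. If \<open>y(0) \<noteq> 0\<close>,
  then \<open>x^m\<close> and \<open>y^m\<close> generate the unit ideal and the target would be all of \<open>K[x]\<close>.
\<close>

theorem alg_iso_eq_tt: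
  fixes A B :: "'a::alg_closed_field poly set"
  assumes m: "0 < m" and A: "A \<in> AAm m" and B: "B \<in> AAm m" and f: "alg_iso A B f"
  obtains c where "c \<noteq> 0" "\<And>g. g \<in> A \<Longrightarrow> f g = tt c g"
proof -
  let ?f' = "inv_into A f"
  obtain y where y: "\<And>g. g \<in> A \<Longrightarrow> f g = pcompose g y"
    using alg_iso_pcompose[OF m A f] by blast
  obtain z where z: "\<And>g. g \<in> B \<Longrightarrow> ?f' g = pcompose g z"
    using alg_iso_pcompose[OF m B alg_iso_inv[OF A f]] by blast
  have bij: "bij_betw f A B" by (rule alg_iso_bij[OF f])
  have yz: "pcompose y z = [:0, 1:]"
  proof (rule pcompose_mutual_inverse[OF A])
    fix g assume g: "g \<in> A"
    then have "f g \<in> B" using bij by (rule bij_betw_apply[rotated])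
    then show "pcompose (pcompose g y) z = g"
      using g y z bij by (metis bij_betw_inv_into_left)
  qed
  have zy: "pcompose z y = [:0, 1:]"
  proof (rule pcompose_mutual_inverse[OF B])
    fix g assume g: "g \<in> B"
    then have "?f' g \<in> A" using bij_betw_inv_into[OF bij] by (rule bij_betw_apply[rotated])
    then show "pcompose (pcompose g z) y = g"
      using g y z bij by (metis bij_betw_inv_into_right)
  qed
  have "degree y * degree z = 1" using degree_pcompose[of y z] by (simp add: yz)
  then have "degree y = 1" by simp
  then obtain b c where bc: "y = [:b, c:]" "c \<noteq> 0"
    by (cases y rule: pCons_cases) (auto split: if_splits elim: degree_eq_zeroE)
  have ideal: "y ^ m * h \<in> B" for h
  proof -
    have "f (monom 1 m * pcompose h z) = y ^ m * h"
      using y[OF AAm_conductor[OF A]] zy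
      by (simp add: pcompose_mult pcompose_monom flip: pcompose_assoc)
    then show ?thesis using bij AAm_conductor[OF A] by (metis bij_betw_apply)
  qed
  have "b = 0"
  proof (rule ccontr)
    assume b: "b \<noteq> 0"
    define X where "X = [:0, 1 :: 'a:]"
    have monom_X: "monom 1 i = X ^ i" for i by (simp add: X_def monom_altdef)
    \<comment> \<open>Here k is the degree still missing from 2 * m. At k = 0 one of i, j is at
      least m, so the product lies in one of the two ideals. In the step, the nonzero constant b
      equals y - c * X, and multiplying by it raises the total degree by one.\<close>
    have "X ^ i * y ^ j * h \<in> B" if "i + j + k = 2 * m" for i j k h
      using that
    proof (induction k arbitrary: i j h)
      case 0
      then consider "m \<le> i" | "m \<le> j" by linarith
      then show ?case
      proof cases
        case 1
        then show ?thesis using AAm_monom[OF B, of i "y ^ j * h"] by (simp add: monom_X mult.assoc)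
      next
        case 2
        have "X ^ i * y ^ j * h = y ^ m * (y ^ (j - m) * X ^ i * h)"
          using power_add[of y m "j - m"] 2 by (simp add: mult_ac)
        also have "\<dots> \<in> B" by (rule ideal)
        finally show ?thesis .
      qed
    next
      case (Suc k)
      let ?u = "X ^ i * y ^ j * h"
      have yb: "smult b 1 = y - smult c X" by (simp add: X_def bc one_pCons)
      have "?u = smult (inverse b) (smult b 1 * ?u)" using b by simp
      also have "smult b 1 * ?u = X ^ i * y ^ Suc j * h - smult c (X ^ Suc i * y ^ j * h)"
        unfolding yb by (simp add: algebra_simps)
      also have "smult (inverse b) \<dots> \<in> B"
        using Suc.IH[of i "Suc j" h] Suc.IH[of "Suc i" j h] Suc.prems
        by (intro AAm_smult[OF B] AAm_diff[OF B]) simp_all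
      finally show ?case .
    qed
    \<comment> \<open>The exponents are chosen to reach x^(m-1), the one power whose absence is part
      of \<open>AAm m\<close>.\<close>
    from this[of "m - 1" 0 "m + 1" 1] have "monom 1 (m - 1) \<in> B"
      using m by (simp add: monom_X)
    then show False using AAm_gap[OF B] by simp
  qed
  then show ?thesis using that[of c] bc y by (simp add: tt_def)
qed

section \<open>Coordinates and the torus action\<close>

lemma coeff_tt: "coeff (tt c p) i = c ^ i * coeff p i"
  by (simp add: tt_def coeff_pcompose_linear)

lemma
  shows tt_add: "tt c (p + q) = tt c p + tt c q"
    and tt_mult: "tt c (p * q) = tt c p * tt c q"
    and tt_smult: "tt c (smult a p) = smult a (tt c p)"
    and tt_one: "tt c 1 = 1"
  by (simp_all add: tt_def pcompose_add pcompose_mult pcompose_smult pcompose_1)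

lemma tt_monom: "tt c (monom a k) = monom (c ^ k * a) k"
  by (rule poly_eqI) (simp add: coeff_tt)

lemma tt_tt: "tt c (tt d p) = tt (c * d) p"
  by (rule poly_eqI) (simp add: coeff_tt power_mult_distrib)

lemma tt_1 [simp]: "tt 1 = (\<lambda>p. p)"
  by (rule ext, rule poly_eqI) (simp add: coeff_tt)

lemma tt_image_image: "tt c ` tt d ` A = tt (c * d) ` A"
  by (simp add: image_image tt_tt)

lemma tt_inverse_image: "c \<noteq> 0 \<Longrightarrow> tt (inverse c) ` tt c ` A = A"
  by (simp add: tt_image_image)

lemma in_tt_image_iff: "c \<noteq> 0 \<Longrightarrow> p \<in> tt c ` A \<longleftrightarrow> tt (inverse c) p \<in> A"
  by (force simp: tt_tt intro: image_eqI[of _ _ "tt (inverse c) p"])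

lemma AA_D:
  assumes "A \<in> AA m \<Gamma>"
  shows "A \<in> AAm m" and "Gam m A = \<Gamma>"
  using assms by (auto simp: AA_def)

lemma in_GamI:
  assumes A: "A \<in> AAm m" and f: "f \<in> A" "coeff f k \<noteq> 0" "\<forall>j<k. coeff f j = 0" and k: "1 \<le> k" "k \<le> m - 1"
  shows "k \<in> Gam m A"
  unfolding Gam_def using assms
  by (intro CollectI conjI bexI[of _ "smult (inverse (coeff f k)) f"]) (auto intro: AAm_smult)

lemma tt_AA:
  assumes c: "c \<noteq> 0" and A: "A \<in> AA m \<Gamma>"
  shows "tt c ` A \<in> AA m \<Gamma>"
proof -
  note A' = AA_D(1)[OF A]
  have mem: "p \<in> tt c ` A \<longleftrightarrow> tt (inverse c) p \<in> A" for p using c by (rule in_tt_image_iff)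
  have tm: "tt (inverse c) (monom 1 k) = smult (inverse c ^ k) (monom 1 k)" for k
    by (simp add: tt_monom smult_monom)
  have "subalgebra (tt c ` A)"
    unfolding subalgebra_def mem tt_add tt_mult tt_smult tt_one
    using A' by (auto simp: AAm_one AAm_add AAm_mult AAm_smult tt_tt c)
  moreover have "monom 1 m * q \<in> tt c ` A" for q
    unfolding mem tt_mult tm mult_smult_left using A' by (intro AAm_smult AAm_conductor)
  moreover have "monom 1 (m - 1) \<notin> tt c ` A"
  proof
    assume "monom 1 (m - 1) \<in> tt c ` A"
    then have "smult (c ^ (m - 1)) (smult (inverse c ^ (m - 1)) (monom 1 (m - 1))) \<in> A"
      unfolding mem tm by (rule AAm_smult[OF A'])
    then show False using AAm_gap[OF A'] c by (simp add: power_inverse)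
  qed
  ultimately have B: "tt c ` A \<in> AAm m" by (simp add: AAm_def)
  have "k \<in> Gam m (tt c ` A) \<longleftrightarrow> k \<in> Gam m A" for k
  proof
    assume "k \<in> Gam m (tt c ` A)"
    then obtain f where f: "tt (inverse c) f \<in> A" "coeff f k = 1" "\<forall>j<k. coeff f j = 0"
      and k: "1 \<le> k" "k \<le> m - 1" unfolding Gam_def mem[symmetric] by blast
    show "k \<in> Gam m A" using A' f(1) _ _ k by (rule in_GamI) (use f c in \<open>auto simp: coeff_tt\<close>)
  next
    assume "k \<in> Gam m A"
    then obtain f where f: "f \<in> A" "coeff f k = 1" "\<forall>j<k. coeff f j = 0"
      and k: "1 \<le> k" "k \<le> m - 1" unfolding Gam_def by blast
    show "k \<in> Gam m (tt c ` A)"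
      using B imageI[OF f(1)] _ _ k by (rule in_GamI) (use f c in \<open>auto simp: coeff_tt\<close>)
  qed
  then show ?thesis using B AA_D(2)[OF A] by (auto simp: AA_def)
qed

lemma
  assumes "A \<in> AA m \<Gamma>" and "\<gamma> \<in> \<Gamma>"
  shows canon_in: "canon m \<Gamma> A \<gamma> \<in> A"
    and canon_form_canon: "canon_form m \<Gamma> \<gamma> (canon m \<Gamma> A \<gamma>)"
  using theI'[OF canon_exists_unique[OF assms]] by (simp_all add: canon_def)

lemma canon_eqI:
  "A \<in> AA m \<Gamma> \<Longrightarrow> \<gamma> \<in> \<Gamma> \<Longrightarrow> f \<in> A \<Longrightarrow> canon_form m \<Gamma> \<gamma> f \<Longrightarrow> canon m \<Gamma> A \<gamma> = f"
  unfolding canon_def by (rule the1_equality[OF canon_exists_unique]) auto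

lemma ind_subset: "ind \<Gamma> \<subseteq> \<Gamma>"
  by (auto simp: ind_def)

text \<open>Dividing t_c(f_\<nu>) by c^\<nu> restores the leading coefficient and keeps the support.
  By uniqueness the result is the canonical element of the image algebra, and c^(j - \<nu>) is what
  remains at x^j.\<close>

lemma coord_tt:
  assumes c: "c \<noteq> 0" and A: "A \<in> AA m \<Gamma>" and "\<nu> \<in> \<Gamma>" and "j \<in> CC m \<Gamma> \<nu>"
  shows "coord m \<Gamma> (tt c ` A) \<nu> j = c ^ (j - \<nu>) * coord m \<Gamma> A \<nu> j"
proof -
  let ?f = "smult (inverse (c ^ \<nu>)) (tt c (canon m \<Gamma> A \<nu>))"
  have "canon m \<Gamma> (tt c ` A) \<nu> = ?f"
  proof (rule canon_eqI)
    show B: "tt c ` A \<in> AA m \<Gamma>" using c A by (rule tt_AA)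
    show "?f \<in> tt c ` A"
      using canon_in[OF A assms(3)] by (intro AAm_smult[OF AA_D(1)[OF B]] imageI)
    show "canon_form m \<Gamma> \<nu> ?f"
      using canon_form_canon[OF A assms(3)] c unfolding canon_form_iff by (simp add: coeff_tt)
  qed fact
  moreover have "\<nu> \<le> j" using assms(4) by (auto simp: CC_def)
  ultimately show ?thesis using c by (simp add: coord_def coeff_tt power_diff field_simps)
qed

section \<open>Algebras are determined by their coordinates\<close>

lemma poly_eq_monom_mult_shift:
  fixes f :: "'a::comm_semiring_1 poly"
  shows "\<forall>j<k. coeff f j = 0 \<Longrightarrow> f = monom 1 k * poly_shift k f"
  by (rule poly_eqI) (auto simp: coeff_monom_mult coeff_poly_shift)

lemma coeff_mult_lowest:
  fixes p q :: "'a::comm_ring_1 poly"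
  assumes "\<forall>j<a. coeff p j = 0" and "\<forall>j<b. coeff q j = 0"
  shows "coeff (p * q) (a + b) = coeff p a * coeff q b" and "\<forall>j<a + b. coeff (p * q) j = 0"
proof -
  have monom_add: "monom 1 (a + b) = monom 1 a * (monom 1 b :: 'a poly)"
    by (simp add: mult_monom)
  have "p * q = (monom 1 a * poly_shift a p) * (monom 1 b * poly_shift b q)"
    using assms by (metis poly_eq_monom_mult_shift)
  also have "\<dots> = monom 1 (a + b) * (poly_shift a p * poly_shift b q)"
    unfolding monom_add by (simp only: mult_ac)
  finally have eq: "p * q = monom 1 (a + b) * (poly_shift a p * poly_shift b q)" .
  show "coeff (p * q) (a + b) = coeff p a * coeff q b"
  proof -
    have low: "coeff (monom 1 (a + b) * r) (a + b) = coeff r 0" for r :: "'a poly"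
      by (simp add: coeff_monom_mult)
    show ?thesis unfolding eq low by (simp add: coeff_mult coeff_poly_shift)
  qed
  show "\<forall>j<a + b. coeff (p * q) j = 0" unfolding eq by (simp add: coeff_monom_mult)
qed

text \<open>Every element of \<Gamma> is a sum of indecomposables, so products of the shared
  canonical elements provide, for each order in \<Gamma>, an element of that order in both A and B.
  With these, the coefficients of an element of A are cleared from the bottom until the rest lies in
  x^m K[x], which B contains.\<close>

lemma AA_subset_if_canon_eq:
  assumes A: "A \<in> AA m \<Gamma>" and B: "B \<in> AA m \<Gamma>"
    and eq: "\<And>\<nu>. \<nu> \<in> ind \<Gamma> \<Longrightarrow> canon m \<Gamma> A \<nu> = canon m \<Gamma> B \<nu>"
  shows "A \<subseteq> B"
proof
  note A' = AA_D(1)[OF A] and B' = AA_D(1)[OF B]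
  have lead: "\<exists>g\<in>A \<inter> B. coeff g \<gamma> = 1 \<and> (\<forall>j<\<gamma>. coeff g j = 0)" if "\<gamma> \<in> \<Gamma>" for \<gamma>
    using that
  proof (induction \<gamma> rule: less_induct)
    case (less \<gamma>)
    show ?case
    proof (cases "\<gamma> \<in> ind \<Gamma>")
      case True
      then have "canon m \<Gamma> A \<gamma> \<in> A \<inter> B"
        using eq[of \<gamma>] canon_in[OF A less.prems] canon_in[OF B less.prems] by simp
      then show ?thesis
        using canon_form_canon[OF A less.prems] unfolding canon_form_iff
        by (intro bexI[of _ "canon m \<Gamma> A \<gamma>"]) (auto simp: CC_def)
    next
      case False
      then obtain a b where ab: "a \<in> \<Gamma>" "b \<in> \<Gamma>" "\<gamma> = a + b"
        using less.prems by (auto simp: ind_def)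
      moreover have "1 \<le> a" "1 \<le> b" using ab AA_D(2)[OF A] by (auto simp: Gam_def)
      ultimately obtain g h where
        g: "g \<in> A" "g \<in> B" "coeff g a = 1" "\<forall>j<a. coeff g j = 0" and
        h: "h \<in> A" "h \<in> B" "coeff h b = 1" "\<forall>j<b. coeff h j = 0"
        using less.IH[of a] less.IH[of b] by auto
      show ?thesis
        using coeff_mult_lowest[OF g(4) h(4)] g h A' B'
        by (intro bexI[of _ "g * h"]) (auto simp: ab(3) intro: AAm_mult)
    qed
  qed
  have "f \<in> B" if "f \<in> A" "\<forall>j<k. coeff f j = 0" for f k
    using that
  proof (induction "m - k" arbitrary: f k)
    case 0
    then have "monom 1 m * poly_shift m f = f"
      using poly_eq_monom_mult_shift[of m f] by simp
    then show ?case using AAm_conductor[OF B'] by metis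
  next
    case (Suc d)
    then have km: "k < m" by simp
    \<comment> \<open>g clears the coefficient at k: it is 0 if that coefficient vanishes already, 1
      if k = 0, and otherwise a common element of order k, since then k lies in \<Gamma>.\<close>
    obtain g where g: "g \<in> A" "g \<in> B" "\<forall>j<k. coeff g j = 0" "coeff f k = 0 \<or> coeff g k = 1"
    proof (cases "coeff f k = 0 \<or> k = 0")
      case True
      then show ?thesis using that[of 1] that[of 0] A' B' AAm_one
        AAm_smult[OF A' AAm_one[OF A'], of 0] AAm_smult[OF B' AAm_one[OF B'], of 0] by auto
    next
      case False
      then have "k \<in> Gam m A" using km Suc.prems by (intro in_GamI[OF A']) auto
      then show ?thesis using lead[of k] AA_D(2)[OF A] that by auto
    qed
    let ?h = "f - smult (coeff f k) g"
    have "?h \<in> A" using A' Suc.prems g by (intro AAm_diff AAm_smult)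
    moreover have "\<forall>j<Suc k. coeff ?h j = 0" using Suc.prems g by (auto simp: less_Suc_eq)
    moreover have "d = m - Suc k" using Suc.hyps by simp
    ultimately have "?h \<in> B" using Suc.hyps by blast
    then have "?h + smult (coeff f k) g \<in> B" using B' g by (intro AAm_add AAm_smult)
    then show ?case by simp
  qed
  then show "f \<in> B" if "f \<in> A" for f using that by blast
qed

text \<open>Injectivity of the passage to affine space: outside \<open>CC m \<Gamma> \<nu>\<close>
  the shape of a canonical element already fixes its coefficients.\<close>

lemma AA_eqI:
  assumes A: "A \<in> AA m \<Gamma>" and B: "B \<in> AA m \<Gamma>"
    and eq: "\<And>\<nu> j. \<nu> \<in> ind \<Gamma> \<Longrightarrow> j \<in> CC m \<Gamma> \<nu> \<Longrightarrow> coord m \<Gamma> A \<nu> j = coord m \<Gamma> B \<nu> j"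
  shows "A = B"
proof -
  have "canon m \<Gamma> A \<nu> = canon m \<Gamma> B \<nu>" if \<nu>: "\<nu> \<in> ind \<Gamma>" for \<nu>
  proof (rule poly_eqI)
    fix j
    have "\<nu> \<in> \<Gamma>" using \<nu> ind_subset by blast
    then show "coeff (canon m \<Gamma> A \<nu>) j = coeff (canon m \<Gamma> B \<nu>) j"
      using canon_form_canon[OF A] canon_form_canon[OF B] eq[OF \<nu>, of j]
      unfolding canon_form_iff coord_def by metis
  qed
  then show ?thesis
    using AA_subset_if_canon_eq[OF A B] AA_subset_if_canon_eq[OF B A] by auto
qed

lemma tt_image_eq_iff:
  assumes c: "c \<noteq> 0" and A: "A \<in> AA m \<Gamma>"
  shows "tt c ` A = A \<longleftrightarrow>
    (\<forall>\<nu>\<in>ind \<Gamma>. \<forall>j\<in>CC m \<Gamma> \<nu>. coord m \<Gamma> A \<nu> j \<noteq> 0 \<longrightarrow> c ^ (j - \<nu>) = 1)"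
proof -
  have co: "coord m \<Gamma> (tt c ` A) \<nu> j = c ^ (j - \<nu>) * coord m \<Gamma> A \<nu> j"
    if "\<nu> \<in> ind \<Gamma>" "j \<in> CC m \<Gamma> \<nu>" for \<nu> j
    using coord_tt[OF c A] that ind_subset by blast
  show ?thesis
  proof
    assume "tt c ` A = A"
    then show "\<forall>\<nu>\<in>ind \<Gamma>. \<forall>j\<in>CC m \<Gamma> \<nu>. coord m \<Gamma> A \<nu> j \<noteq> 0 \<longrightarrow> c ^ (j - \<nu>) = 1"
      using co by auto
  next
    assume "\<forall>\<nu>\<in>ind \<Gamma>. \<forall>j\<in>CC m \<Gamma> \<nu>. coord m \<Gamma> A \<nu> j \<noteq> 0 \<longrightarrow> c ^ (j - \<nu>) = 1"
    then show "tt c ` A = A" by (intro AA_eqI[OF tt_AA[OF c A] A]) (auto simp: co)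
  qed
qed

section \<open>The monomial algebra\<close>

lemma Amon_iff:
  fixes p :: "'a::field poly"
  assumes \<Gamma>: "\<Gamma> \<in> SS m" and m: "4 \<le> m"
  shows "p \<in> Amon m \<Gamma> \<longleftrightarrow> (\<forall>j<m. j \<noteq> 0 \<longrightarrow> j \<notin> \<Gamma> \<longrightarrow> coeff p j = 0)"
proof -
  have sub: "\<Gamma> \<subseteq> {2..m - 2}" using \<Gamma> by (auto simp: SS_def)
  then have fin: "finite \<Gamma>" by (rule finite_subset) simp
  have co: "coeff ([:c:] + (\<Sum>\<gamma>\<in>\<Gamma>. monom (a \<gamma>) \<gamma>) + monom 1 m * q) j
    = (if j = 0 then c else 0) + (if j \<in> \<Gamma> then a j else 0) + (if m \<le> j then coeff q (j - m) else 0)"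
    for c :: 'a and a q j
    using fin by (simp add: coeff_sum coeff_monom_mult coeff_pCons split: nat.splits)
  show ?thesis
  proof
    assume "p \<in> Amon m \<Gamma>"
    then obtain c a q where p: "p = [:c:] + (\<Sum>\<gamma>\<in>\<Gamma>. monom (a \<gamma>) \<gamma>) + monom 1 m * q"
      by (auto simp: Amon_def)
    show "\<forall>j<m. j \<noteq> 0 \<longrightarrow> j \<notin> \<Gamma> \<longrightarrow> coeff p j = 0" unfolding p co by simp
  next
    assume "\<forall>j<m. j \<noteq> 0 \<longrightarrow> j \<notin> \<Gamma> \<longrightarrow> coeff p j = 0"
    then have "p = [:coeff p 0:] + (\<Sum>\<gamma>\<in>\<Gamma>. monom (coeff p \<gamma>) \<gamma>) + monom 1 m * poly_shift m p"
      using sub m by (intro poly_eqI, unfold co) (auto simp: coeff_poly_shift)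
    then show "p \<in> Amon m \<Gamma>" unfolding Amon_def by blast
  qed
qed

text \<open>Closure under products is the sum condition in \<open>SS\<close>: a nonzero term at j <
  m splits j into two indices that are 0 or in \<Gamma>. The gap at m - 1 comes from \<Gamma> being
  contained in {2..m - 2}.\<close>

lemma Amon_AA:
  assumes \<Gamma>: "\<Gamma> \<in> SS m" and m: "4 \<le> m"
  shows "Amon m \<Gamma> \<in> (AA m \<Gamma> :: 'a::field poly set set)"
proof -
  have sub: "\<Gamma> \<subseteq> {2..m - 2}" and sum: "\<And>a b. a \<in> \<Gamma> \<Longrightarrow> b \<in> \<Gamma> \<Longrightarrow> a + b < m \<Longrightarrow> a + b \<in> \<Gamma>"
    using \<Gamma> by (auto simp: SS_def not_le[symmetric])
  note mem = Amon_iff[OF \<Gamma> m]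
  have "p * q \<in> Amon m \<Gamma>" if p: "p \<in> Amon m \<Gamma>" and q: "q \<in> Amon m \<Gamma>" for p q :: "'a poly"
    unfolding mem
  proof (intro allI impI)
    fix j assume j: "j < m" "j \<noteq> 0" "j \<notin> \<Gamma>"
    have "coeff p i * coeff q (j - i) = 0" if "i \<le> j" for i
    proof (rule ccontr)
      assume "coeff p i * coeff q (j - i) \<noteq> 0"
      then have "coeff p i \<noteq> 0" "coeff q (j - i) \<noteq> 0" by auto
      moreover have "i < m" "j - i < m" using j that by auto
      ultimately have "i = 0 \<or> i \<in> \<Gamma>" "j - i = 0 \<or> j - i \<in> \<Gamma>"
        using p q unfolding mem by blast+
      then show False using j that sum[of i "j - i"] by auto
    qed
    then show "coeff (p * q) j = 0" unfolding coeff_mult by (intro sum.neutral) auto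
  qed
  then have "subalgebra (Amon m \<Gamma> :: 'a poly set)"
    unfolding subalgebra_def by (simp add: mem coeff_1)
  moreover have "monom 1 m * q \<in> Amon m \<Gamma>" for q :: "'a poly" by (simp add: mem coeff_monom_mult)
  moreover have "monom 1 (m - 1) \<notin> (Amon m \<Gamma> :: 'a poly set)"
  proof -
    have "m - 1 \<notin> {2..m - 2}" "m - 1 < m" "m - 1 \<noteq> 0" using m by auto
    then have "m - 1 < m" "m - 1 \<noteq> 0" "m - 1 \<notin> \<Gamma>" using sub by blast+
    then show ?thesis unfolding mem by (metis coeff_monom zero_neq_one)
  qed
  ultimately have "Amon m \<Gamma> \<in> (AAm m :: 'a poly set set)" by (simp add: AAm_def)
  moreover have "Gam m (Amon m \<Gamma> :: 'a poly set) = \<Gamma>"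
  proof (intro equalityI subsetI)
    fix k assume "k \<in> Gam m (Amon m \<Gamma> :: 'a poly set)"
    then obtain f :: "'a poly" where "f \<in> Amon m \<Gamma>" "coeff f k = 1" "1 \<le> k" "k \<le> m - 1"
      by (auto simp: Gam_def)
    moreover have "k < m" "k \<noteq> 0" using calculation m by auto
    ultimately show "k \<in> \<Gamma>" unfolding mem by (metis zero_neq_one)
  next
    fix k assume "k \<in> \<Gamma>"
    moreover have "1 \<le> k" "k \<le> m - 1" using sub calculation by force+
    ultimately show "k \<in> Gam m (Amon m \<Gamma> :: 'a poly set)"
      unfolding Gam_def
      by (intro CollectI conjI bexI[of _ "monom 1 k"]) (auto simp: mem)
  qed
  ultimately show ?thesis by (simp add: AA_def)
qed

lemma coord_Amon:
  assumes \<Gamma>: "\<Gamma> \<in> SS m" and m: "4 \<le> m" and \<nu>: "\<nu> \<in> \<Gamma>" and "j \<in> CC m \<Gamma> \<nu>"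
  shows "coord m \<Gamma> (Amon m \<Gamma> :: 'a::field poly set) \<nu> j = 0"
proof -
  have "canon m \<Gamma> (Amon m \<Gamma>) \<nu> = (monom 1 \<nu> :: 'a poly)"
    using Amon_AA[OF \<Gamma> m] \<nu>
    by (rule canon_eqI) (use \<nu> in \<open>auto simp: Amon_iff[OF \<Gamma> m] canon_form_iff\<close>)
  then show ?thesis using assms(4) by (simp add: coord_def CC_def)
qed

lemma eq_Amon_iff:
  assumes "\<Gamma> \<in> SS m" and "4 \<le> m" and "A \<in> AA m \<Gamma>"
  shows "A = Amon m \<Gamma> \<longleftrightarrow> (\<forall>\<nu>\<in>ind \<Gamma>. \<forall>j\<in>CC m \<Gamma> \<nu>. coord m \<Gamma> A \<nu> j = 0)"
proof
  assume "A = Amon m \<Gamma>"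
  then show "\<forall>\<nu>\<in>ind \<Gamma>. \<forall>j\<in>CC m \<Gamma> \<nu>. coord m \<Gamma> A \<nu> j = 0"
    using coord_Amon[OF assms(1,2)] ind_subset by blast
next
  assume 0: "\<forall>\<nu>\<in>ind \<Gamma>. \<forall>j\<in>CC m \<Gamma> \<nu>. coord m \<Gamma> A \<nu> j = 0"
  show "A = Amon m \<Gamma>"
  proof (rule AA_eqI[OF assms(3) Amon_AA[OF assms(1,2)]])
    fix \<nu> j assume "\<nu> \<in> ind \<Gamma>" "j \<in> CC m \<Gamma> \<nu>"
    with 0 show "coord m \<Gamma> A \<nu> j = coord m \<Gamma> (Amon m \<Gamma>) \<nu> j"
      using coord_Amon[OF assms(1,2), of \<nu> j] ind_subset by auto
  qed
qed

section \<open>Stabilisers and strata\<close>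

text \<open>Scalars are collected instead of maps, so that the stabiliser can be compared directly
  with {c. c^n = 1}.\<close>

definition torus_stab :: "'a::field poly set \<Rightarrow> 'a set" where
  "torus_stab A = {c. c \<noteq> 0 \<and> tt c ` A = A}"

lemma torus_stab_roots_of_unity:
  fixes A :: "'a::field poly set"
  assumes \<Gamma>: "\<Gamma> \<in> SS m" and m: "4 \<le> m" and A: "A \<in> AA m \<Gamma>" and "A \<noteq> Amon m \<Gamma>"
  obtains n where "1 \<le> n" "n \<le> m" "\<not> CHAR('a) dvd n" "torus_stab A = {c. c ^ n = 1}"
proof -
  define S where "S = {j - \<nu> | \<nu> j. \<nu> \<in> ind \<Gamma> \<and> j \<in> CC m \<Gamma> \<nu> \<and> coord m \<Gamma> A \<nu> j \<noteq> 0}"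
  have "S \<subseteq> {1..m}" by (auto simp: S_def CC_def)
  then have fin: "finite S" by (rule finite_subset) simp
  obtain k where k: "k \<in> S" using assms eq_Amon_iff[OF \<Gamma> m A] by (auto simp: S_def)
  with \<open>S \<subseteq> {1..m}\<close> have "1 \<le> k" "k \<le> m" by auto
  have "Gcd S dvd k" using k by simp
  \<comment> \<open>\<open>Gcd S\<close> divides an element of {1..m}, hence is positive and at most
    m; the upper bound later makes \<open>aut_orders\<close> finite.\<close>
  then have G: "1 \<le> Gcd S" "Gcd S \<le> m"
    using \<open>1 \<le> k\<close> \<open>k \<le> m\<close> dvd_imp_le[of "Gcd S" k] by (auto simp: Suc_le_eq intro!: gr0I)
  have "c \<in> torus_stab A \<longleftrightarrow> c ^ Gcd S = 1" for c
  proof (cases "c = 0")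
    case True
    \<comment> \<open>0 is excluded from the stabiliser, so it must not solve the equation; a
      positive exponent ensures this.\<close>
    have "(0 :: 'a) ^ Gcd S \<noteq> 1" by (metis G(1) less_le_trans zero_less_one zero_neq_one zero_power)
    then show ?thesis by (simp only: torus_stab_def True mem_Collect_eq simp_thms)
  next
    case False
    then have "c \<in> torus_stab A \<longleftrightarrow> (\<forall>k\<in>S. c ^ k = 1)"
      unfolding torus_stab_def mem_Collect_eq tt_image_eq_iff[OF False A] S_def by blast
    then show ?thesis by (simp add: power_Gcd_eq_1_iff[OF fin])
  qed
  then have stab: "torus_stab A = {c. c ^ Gcd S = 1}" by blast
  obtain n where "1 \<le> n" "n \<le> Gcd S" "\<not> CHAR('a) dvd n" "{c :: 'a. c ^ Gcd S = 1} = {c. c ^ n = 1}"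
    using roots_of_unity_prime_to_char[OF G(1)] by blast
  with stab G(2) show ?thesis by (intro that[of n]) simp_all
qed

lemma torus_stab_Amon:
  assumes "\<Gamma> \<in> SS m" and "4 \<le> m"
  shows "torus_stab (Amon m \<Gamma>) = {c. c \<noteq> 0}"
proof -
  have A: "Amon m \<Gamma> \<in> AA m \<Gamma>" using assms by (rule Amon_AA)
  then have "\<forall>\<nu>\<in>ind \<Gamma>. \<forall>j\<in>CC m \<Gamma> \<nu>. coord m \<Gamma> (Amon m \<Gamma>) \<nu> j = 0"
    using eq_Amon_iff[OF assms] by blast
  then have "tt c ` Amon m \<Gamma> = Amon m \<Gamma>" if "c \<noteq> 0" for c
    using tt_image_eq_iff[OF that A] by blast
  then show ?thesis by (auto simp only: torus_stab_def)
qed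

lemma infinite_torus_stab_Amon:
  assumes "\<Gamma> \<in> SS m" and "4 \<le> m"
  shows "infinite (torus_stab (Amon m \<Gamma> :: 'a::alg_closed_field poly set))"
proof
  assume "finite (torus_stab (Amon m \<Gamma> :: 'a poly set))"
  then have "finite (insert 0 {c :: 'a. c \<noteq> 0})" by (simp add: torus_stab_Amon[OF assms])
  moreover have "insert 0 {c :: 'a. c \<noteq> 0} = UNIV" by auto
  ultimately show False using infinite_UNIV_alg_closed by metis
qed

text \<open>The torus is commutative, so stabilisers are constant on orbits. Conditions on the
  stabiliser therefore descend to the quotient.\<close>

lemma torus_stab_tt:
  assumes d: "d \<noteq> 0"
  shows "torus_stab (tt d ` A) = torus_stab A"
proof -
  have "tt c ` tt d ` A = tt d ` A \<longleftrightarrow> tt c ` A = A" for c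
  proof -
    have "tt c ` tt d ` A = tt d ` tt c ` A" by (simp add: tt_image_image mult.commute)
    moreover have "tt d ` B = tt d ` A \<longleftrightarrow> B = A" for B using tt_inverse_image[OF d] by metis
    ultimately show ?thesis by metis
  qed
  then show ?thesis by (simp add: torus_stab_def)
qed

section \<open>Automorphism groups and isomorphism classes\<close>

lemma alg_iso_tt: "c \<noteq> 0 \<Longrightarrow> alg_iso A (tt c ` A) (tt c)"
  unfolding alg_iso_def bij_betw_def inj_on_def
  by (auto simp: tt_add tt_mult tt_smult tt_one) (metis tt_tt tt_1 left_inverse)

lemma alg_iso_cong:
  assumes "A \<in> AAm m" and "\<And>p. p \<in> A \<Longrightarrow> f p = g p"
  shows "alg_iso A B f \<longleftrightarrow> alg_iso A B g"
proof -
  have "bij_betw f A B \<longleftrightarrow> bij_betw g A B" using assms(2) by (rule bij_betw_cong)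
  then show ?thesis
    using assms by (simp add: alg_iso_def AAm_one AAm_add AAm_mult AAm_smult)
qed

lemma Aut_eq_on_alg:
  fixes A :: "'a::alg_closed_field poly set"
  assumes m: "0 < m" and A: "A \<in> AAm m"
  shows "Aut A = on_alg (tt ` torus_stab A) A"
proof (intro equalityI subsetI)
  fix f assume "f \<in> Aut A"
  then have f: "f \<in> extensional A" "alg_iso A A f" by (auto simp: Aut_def)
  obtain c where c: "c \<noteq> 0" "\<And>g. g \<in> A \<Longrightarrow> f g = tt c g" 
    using alg_iso_eq_tt[OF m A A f(2)] by blast
  have "tt c ` A = f ` A" using c(2) by simp
  then have "c \<in> torus_stab A"
    using alg_iso_bij[OF f(2)] c(1) by (simp add: torus_stab_def bij_betw_def)
  moreover have "f = restrict (tt c) A"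
    using f(1) c(2) by (intro extensionalityI[of f A]) auto
  ultimately show "f \<in> on_alg (tt ` torus_stab A) A" by (auto simp: on_alg_def)
next
  fix f assume "f \<in> on_alg (tt ` torus_stab A) A"
  then obtain c where c: "c \<noteq> 0" "tt c ` A = A" "f = restrict (tt c) A"
    by (auto simp: on_alg_def torus_stab_def)
  then have "alg_iso A A f"
    using alg_iso_cong[OF A, of f "tt c" A] alg_iso_tt[of c A] by simp
  then show "f \<in> Aut A" using c(3) by (simp add: Aut_def)
qed

text \<open>A contains x^m and x^(m+1); equality of c and d in these two powers forces c = d. Thus
  restriction to A loses no torus element, and group orders can be computed in the torus.\<close>

lemma inj_on_restrict_tt:
  assumes A: "A \<in> AAm m"
  shows "inj_on (\<lambda>c. restrict (tt c) A) {c. c \<noteq> 0}"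
proof (rule inj_onI)
  fix c d assume cd: "c \<in> {c. c \<noteq> 0}" "d \<in> {c. c \<noteq> 0}" and eq: "restrict (tt c) A = restrict (tt d) A"
  have "c ^ k = d ^ k" if "m \<le> k" for k
  proof -
    have "monom 1 k \<in> A" using AAm_monom[OF A that, of 1] by simp
    then have "tt c (monom 1 k) = tt d (monom 1 k)" using eq by (metis restrict_apply')
    then show ?thesis by (simp add: tt_monom)
  qed
  from this[of m] this[of "Suc m"] show "c = d" using cd by auto
qed

lemma on_alg_tt: "on_alg (tt ` S) A = (\<lambda>c. restrict (tt c) A) ` S"
  by (simp add: on_alg_def image_image)

lemma
  fixes A :: "'a::alg_closed_field poly set"
  assumes m: "0 < m" and A: "A \<in> AAm m"
  shows finite_Aut_iff: "finite (Aut A) \<longleftrightarrow> finite (torus_stab A)"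
    and card_Aut: "card (Aut A) = card (torus_stab A)"
    and on_alg_subset_Aut_iff: "0 \<notin> S \<Longrightarrow> on_alg (tt ` S) A \<subseteq> Aut A \<longleftrightarrow> S \<subseteq> torus_stab A"
    and on_alg_eq_Aut_iff: "0 \<notin> S \<Longrightarrow> on_alg (tt ` S) A = Aut A \<longleftrightarrow> S = torus_stab A"
proof -
  note inj = inj_on_restrict_tt[OF A]
  have sub: "torus_stab A \<subseteq> {c. c \<noteq> 0}" by (auto simp: torus_stab_def)
  note inj' = inj_on_subset[OF inj sub]
  have eq: "Aut A = (\<lambda>c. restrict (tt c) A) ` torus_stab A"
    by (simp add: Aut_eq_on_alg[OF m A] on_alg_tt)
  show "finite (Aut A) \<longleftrightarrow> finite (torus_stab A)" unfolding eq by (rule finite_image_iff[OF inj'])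
  show "card (Aut A) = card (torus_stab A)" unfolding eq by (rule card_image[OF inj'])
  assume "0 \<notin> S"
  then have S: "S \<subseteq> {c. c \<noteq> 0}" by auto
  show "on_alg (tt ` S) A \<subseteq> Aut A \<longleftrightarrow> S \<subseteq> torus_stab A"
    unfolding on_alg_tt eq image_subset_iff using S inj_on_image_mem_iff[OF inj _ sub] by blast
  show "on_alg (tt ` S) A = Aut A \<longleftrightarrow> S = torus_stab A"
    unfolding on_alg_tt eq by (rule inj_on_image_eq_iff[OF inj S sub])
qed

lemma torus_orbit_eq: "torus_orbit A = {tt c ` A | c. c \<noteq> 0}"
  by (auto simp: torus_orbit_def TT_def)

lemma torus_orbit_refl: "A \<in> torus_orbit A"
  unfolding torus_orbit_eq by (auto intro!: exI[of _ 1])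

lemma torus_orbit_eqD:
  assumes "torus_orbit A = torus_orbit B"
  obtains c where "c \<noteq> 0" "A = tt c ` B"
  using assms torus_orbit_refl[of A] unfolding torus_orbit_eq by auto

lemma iso_class_eq_torus_orbit:
  fixes A :: "'a::alg_closed_field poly set"
  assumes m: "0 < m" and A: "A \<in> AA m \<Gamma>"
  shows "iso_class m \<Gamma> A = torus_orbit A"
proof (intro equalityI subsetI)
  fix B assume "B \<in> iso_class m \<Gamma> A"
  then obtain f where B: "B \<in> AA m \<Gamma>" "alg_iso A B f" by (auto simp: iso_class_def)
  then obtain c where c: "c \<noteq> 0" "\<And>g. g \<in> A \<Longrightarrow> f g = tt c g"
    using alg_iso_eq_tt[OF m AA_D(1)[OF A] AA_D(1)[OF B(1)] B(2)] by blast
  have "B = f ` A" using alg_iso_bij[OF B(2)] by (simp add: bij_betw_def)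
  also have "\<dots> = tt c ` A" using c(2) by simp
  finally show "B \<in> torus_orbit A" using c(1) by (auto simp: torus_orbit_eq)
next
  fix B assume "B \<in> torus_orbit A"
  then obtain c where "c \<noteq> 0" "B = tt c ` A" by (auto simp: torus_orbit_eq)
  then show "B \<in> iso_class m \<Gamma> A"
    using tt_AA[OF _ A, of c] alg_iso_tt[of c A] by (auto simp: iso_class_def)
qed

text \<open>Common pattern for items 2 to 4: a condition P on automorphisms is exchanged for a
  condition Q on stabilisers while classes become orbits.\<close>

lemma iso_classes_eq:
  assumes m: "0 < m" and PQ: "\<And>A :: 'a::alg_closed_field poly set. A \<in> AA m \<Gamma> \<Longrightarrow> P A \<longleftrightarrow> Q A"
  shows "{iso_class m \<Gamma> A | A. A \<in> AA m \<Gamma> \<and> P A} = torus_orbit ` {A \<in> AA m \<Gamma>. Q A}"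
proof -
  have "{iso_class m \<Gamma> A | A. A \<in> AA m \<Gamma> \<and> P A} = iso_class m \<Gamma> ` {A \<in> AA m \<Gamma>. Q A}"
    using PQ by blast
  also have "\<dots> = torus_orbit ` {A \<in> AA m \<Gamma>. Q A}"
    using iso_class_eq_torus_orbit[OF m] by (intro image_cong) auto
  finally show ?thesis .
qed

section \<open>Fixed points of the cyclic groups\<close>

lemma zero_notin_roots_of_unity: "primitive_root n (z :: 'a::field) \<Longrightarrow> 0 \<notin> {c :: 'a. c ^ n = 1}"
  by (auto simp: primitive_root_def power_0_left)

lemma fixed_Cyc_eq:
  assumes prim: "primitive_root n (unity_root n :: 'a::field)"
  shows "fixed m \<Gamma> (Cyc n) = {A \<in> AA m \<Gamma>. {c :: 'a. c ^ n = 1} \<subseteq> torus_stab A}"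
  using zero_notin_roots_of_unity[OF prim] by (auto simp: fixed_def Cyc_eq[OF prim] torus_stab_def)

text \<open>A nonzero coordinate at (\<nu>, j) requires every n-th root of unity to be a (j -
  \<nu>)-th one, that is, n dvd j - \<nu>.\<close>

lemma fixed_Cyc_eq_coord:
  assumes prim: "primitive_root n (unity_root n :: 'a::field)"
  shows "fixed m \<Gamma> (Cyc n) = {A :: 'a poly set. A \<in> AA m \<Gamma> \<and>
    (\<forall>\<nu>\<in>ind \<Gamma>. \<forall>j\<in>CC m \<Gamma> \<nu>. \<not> n dvd (j - \<nu>) \<longrightarrow> coord m \<Gamma> A \<nu> j = 0)}"
proof -
  have "{c :: 'a. c ^ n = 1} \<subseteq> torus_stab A \<longleftrightarrow>
    (\<forall>\<nu>\<in>ind \<Gamma>. \<forall>j\<in>CC m \<Gamma> \<nu>. \<not> n dvd (j - \<nu>) \<longrightarrow> coord m \<Gamma> A \<nu> j = 0)"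
    if A: "A \<in> AA m \<Gamma>" for A
  proof -
    have "{c :: 'a. c ^ n = 1} \<subseteq> torus_stab A \<longleftrightarrow>
      (\<forall>\<nu>\<in>ind \<Gamma>. \<forall>j\<in>CC m \<Gamma> \<nu>. coord m \<Gamma> A \<nu> j \<noteq> 0 \<longrightarrow> {c :: 'a. c ^ n = 1} \<subseteq> {c. c ^ (j - \<nu>) = 1})"
      using zero_notin_roots_of_unity[OF prim] tt_image_eq_iff[OF _ A]
      unfolding torus_stab_def subset_iff mem_Collect_eq by metis
    then show ?thesis unfolding roots_of_unity_dvd_iff[OF prim] by blast
  qed
  then show ?thesis unfolding fixed_Cyc_eq[OF prim] by blast
qed

section \<open>Closed subsets of the variety\<close>

lemma coords_in_PiE: "coords m \<Gamma> A \<in> coord_index m \<Gamma> \<rightarrow>\<^sub>E UNIV"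
  by (auto simp: coords_def)

lemma topspace_variety: "topspace (variety m \<Gamma>) = (AA m \<Gamma> :: 'a::field poly set set)"
proof -
  let ?I = "coord_index m \<Gamma>"
  \<comment> \<open>The constant polynomial 1 has empty zero locus, so its complement is the whole
    affine space.\<close>
  have "openin (zariski ?I) (?I \<rightarrow>\<^sub>E (UNIV :: 'a set))"
    unfolding openin_zariski zero_locus_def
    by (intro exI[of _ "{\<lambda>v. 1}"]) (auto intro: polyfuns.const)
  then have "?I \<rightarrow>\<^sub>E (UNIV :: 'a set) \<subseteq> topspace (zariski ?I)" by (rule openin_subset)
  then show ?thesis
    unfolding variety_def topspace_pullback_topology using coords_in_PiE by blast
qed

text \<open>R stays free to serve two purposes: non-divisibility gives the fixed sets, and
  \<open>True\<close> gives the single point \<open>Amon m \<Gamma>\<close>.\<close>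

lemma closedin_coord_vanishing:
  "closedin (variety m \<Gamma>) {A :: 'a::field poly set. A \<in> AA m \<Gamma> \<and>
     (\<forall>\<nu>\<in>ind \<Gamma>. \<forall>j\<in>CC m \<Gamma> \<nu>. R \<nu> j \<longrightarrow> coord m \<Gamma> A \<nu> j = 0)}" (is "closedin _ ?Z")
proof -
  let ?I = "coord_index m \<Gamma>" and ?E = "coord_index m \<Gamma> \<rightarrow>\<^sub>E (UNIV :: 'a set)"
  let ?P = "{\<lambda>v :: nat \<times> nat \<Rightarrow> 'a. v (\<nu>, j) | \<nu> j. (\<nu>, j) \<in> ?I \<and> R \<nu> j}"
  have E: "coords m \<Gamma> A \<in> ?E" for A :: "'a poly set"
    by (rule coords_in_PiE)
  have "?P \<subseteq> polyfuns ?I" by (auto intro: polyfuns.var)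
  then have "openin (zariski ?I) (?E - zero_locus ?I ?P)" unfolding openin_zariski by blast
  moreover have "coords m \<Gamma> A \<in> zero_locus ?I ?P \<longleftrightarrow>
    (\<forall>\<nu>\<in>ind \<Gamma>. \<forall>j\<in>CC m \<Gamma> \<nu>. R \<nu> j \<longrightarrow> coord m \<Gamma> A \<nu> j = 0)" for A :: "'a poly set"
  proof -
    have "coords m \<Gamma> A \<in> zero_locus ?I ?P \<longleftrightarrow>
      (\<forall>\<nu> j. (\<nu>, j) \<in> ?I \<and> R \<nu> j \<longrightarrow> coords m \<Gamma> A (\<nu>, j) = 0)"
      unfolding zero_locus_def by (auto simp: E)
    then show ?thesis by (auto simp: coords_def coord_index_def)
  qed
  then have "AA m \<Gamma> - ?Z = coords m \<Gamma> -` (?E - zero_locus ?I ?P) \<inter> AA m \<Gamma>"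
    using E by auto
  ultimately have "openin (variety m \<Gamma>) (AA m \<Gamma> - ?Z)"
    unfolding variety_def openin_pullback_topology by blast
  then show ?thesis unfolding closedin_def topspace_variety by auto
qed

text \<open>A finite automorphism group rules out the monomial algebra, so n is the number of l-th
  roots of unity with l prime to the characteristic; that number is l.\<close>

lemma aut_orders_D:
  assumes \<Gamma>: "\<Gamma> \<in> SS m" and m: "4 \<le> m" and n: "n \<in> aut_orders TYPE('a::alg_closed_field) m \<Gamma>"
  shows "primitive_root n (unity_root n :: 'a)" and "n \<le> m"
proof -
  obtain A :: "'a poly set" where A: "A \<in> AA m \<Gamma>" "finite (Aut A)" "n = card (Aut A)"
    using n by (auto simp: aut_orders_def)
  have m0: "0 < m" using m by simp
  have "finite (torus_stab A)" using A(2) by (simp add: finite_Aut_iff[OF m0 AA_D(1)[OF A(1)]])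
  then have "A \<noteq> Amon m \<Gamma>" using infinite_torus_stab_Amon[OF \<Gamma> m, where 'a='a] by auto
  then obtain l where l: "1 \<le> l" "l \<le> m" "\<not> CHAR('a) dvd l" "torus_stab A = {c. c ^ l = 1}"
    using torus_stab_roots_of_unity[OF \<Gamma> m A(1)] by blast
  note prim = unity_root_primitive[OF l(1,3)]
  have "n = l"
    using A(3) l(4) card_roots_of_unity[OF prim] by (simp add: card_Aut[OF m0 AA_D(1)[OF A(1)]])
  then show "primitive_root n (unity_root n :: 'a)" and "n \<le> m" using prim l by simp_all
qed

text \<open>Guarantees that removing only the fixed sets with index in \<open>aut_orders\<close>
  reaches every larger stabiliser of a non-monomial algebra.\<close>

lemma torus_stab_order:
  fixes A :: "'a::alg_closed_field poly set"
  assumes \<Gamma>: "\<Gamma> \<in> SS m" and m: "4 \<le> m" and A: "A \<in> AA m \<Gamma>" and ne: "A \<noteq> Amon m \<Gamma>"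
  obtains l where "l \<in> aut_orders TYPE('a) m \<Gamma>" "torus_stab A = {c. c ^ l = 1}"
proof -
  obtain l where l: "1 \<le> l" "l \<le> m" "\<not> CHAR('a) dvd l" "torus_stab A = {c. c ^ l = 1}"
    using torus_stab_roots_of_unity[OF \<Gamma> m A ne] by blast
  have m0: "0 < m" using m by simp
  note A' = AA_D(1)[OF A]
  have "finite (Aut A)" unfolding finite_Aut_iff[OF m0 A'] l(4) by (rule finite_roots_of_unity[OF l(1)])
  moreover have "card (Aut A) = l"
    unfolding card_Aut[OF m0 A'] l(4) by (rule card_roots_of_unity[OF unity_root_primitive[OF l(1,3)]])
  ultimately have "l \<in> aut_orders TYPE('a) m \<Gamma>" using A unfolding aut_orders_def by blast
  then show ?thesis using that l(4) by blast
qed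

lemma torus_orbit_in_quot_fixed_iff:
  assumes prim: "primitive_root l (unity_root l :: 'a::field)" and A: "A \<in> AA m \<Gamma>"
  shows "torus_orbit A \<in> quot (fixed m \<Gamma> (Cyc l)) \<longleftrightarrow> {c :: 'a. c ^ l = 1} \<subseteq> torus_stab A"
proof
  assume "torus_orbit A \<in> quot (fixed m \<Gamma> (Cyc l))"
  then obtain B where B: "{c. c ^ l = 1} \<subseteq> torus_stab B" "torus_orbit A = torus_orbit B"
    unfolding quot_def fixed_Cyc_eq[OF prim] by blast
  obtain c where "c \<noteq> 0" "A = tt c ` B" using torus_orbit_eqD[OF B(2)] by blast
  then show "{c. c ^ l = 1} \<subseteq> torus_stab A" using B(1) by (simp add: torus_stab_tt)
next
  assume "{c. c ^ l = 1} \<subseteq> torus_stab A"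
  then show "torus_orbit A \<in> quot (fixed m \<Gamma> (Cyc l))"
    using A unfolding quot_def fixed_Cyc_eq[OF prim] by blast
qed

lemma torus_orbit_eq_Amon_iff:
  assumes "\<Gamma> \<in> SS m" and "4 \<le> m"
  shows "torus_orbit A = torus_orbit (Amon m \<Gamma>) \<longleftrightarrow> A = Amon m \<Gamma>"
proof
  assume "torus_orbit A = torus_orbit (Amon m \<Gamma>)"
  then obtain c where "c \<noteq> 0" "A = tt c ` Amon m \<Gamma>" by (rule torus_orbit_eqD)
  moreover have "c \<in> torus_stab (Amon m \<Gamma>)"
    using \<open>c \<noteq> 0\<close> by (simp add: torus_stab_Amon[OF assms])
  ultimately show "A = Amon m \<Gamma>" by (simp add: torus_stab_def)
qed simp

text \<open>Away from \<open>Amon m \<Gamma>\<close> a stabiliser consists of the l-th roots of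
  unity with l in \<open>aut_orders\<close>; it contains the n-th ones iff n dvd l, and removing the
  proper multiples leaves l = n. Only a primitive root is assumed for n, so the case n = 1 is
  available even if 1 is not in \<open>aut_orders\<close>.\<close>

lemma stratum_eq:
  fixes \<Gamma> :: "nat set"
  assumes \<Gamma>: "\<Gamma> \<in> SS m" and m: "4 \<le> m" and prim: "primitive_root n (unity_root n :: 'a::alg_closed_field)"
  shows "quot (fixed m \<Gamma> (Cyc n)) - ({torus_orbit (Amon m \<Gamma>)} \<union>
      (\<Union>l\<in>{l \<in> aut_orders TYPE('a) m \<Gamma>. l \<noteq> n \<and> n dvd l}. quot (fixed m \<Gamma> (Cyc l))))
    = torus_orbit ` {A \<in> AA m \<Gamma>. torus_stab A = {c :: 'a. c ^ n = 1}}" (is "?L = ?R")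
proof -
  let ?O = "aut_orders TYPE('a) m \<Gamma>" and ?\<mu> = "\<lambda>l. {c :: 'a. c ^ l = 1}"
  have primO: "primitive_root l (unity_root l :: 'a)" if "l \<in> ?O" for l
    using \<Gamma> m that by (rule aut_orders_D)
  have in_L: "torus_orbit A \<in> ?L \<longleftrightarrow> torus_stab A = ?\<mu> n" if A: "A \<in> AA m \<Gamma>" for A
  proof -
    have "torus_orbit A \<in> ?L \<longleftrightarrow> ?\<mu> n \<subseteq> torus_stab A \<and> A \<noteq> Amon m \<Gamma> \<and>
      (\<forall>l\<in>?O. l \<noteq> n \<and> n dvd l \<longrightarrow> \<not> ?\<mu> l \<subseteq> torus_stab A)"
      using torus_orbit_in_quot_fixed_iff[OF prim A] torus_orbit_in_quot_fixed_iff[OF primO A]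
        torus_orbit_eq_Amon_iff[OF \<Gamma> m, of A] by auto
    also have "\<dots> \<longleftrightarrow> torus_stab A = ?\<mu> n"
    proof
      assume L: "?\<mu> n \<subseteq> torus_stab A \<and> A \<noteq> Amon m \<Gamma> \<and>
        (\<forall>l\<in>?O. l \<noteq> n \<and> n dvd l \<longrightarrow> \<not> ?\<mu> l \<subseteq> torus_stab A)"
      then obtain l where l: "l \<in> ?O" "torus_stab A = ?\<mu> l"
        using torus_stab_order[OF \<Gamma> m A] by blast
      then have "n dvd l" using L roots_of_unity_dvd_iff[OF prim] by blast
      then have "l = n" using L l by blast
      then show "torus_stab A = ?\<mu> n" using l by simp
    next
      assume R: "torus_stab A = ?\<mu> n"
      have "1 \<le> n" using prim by (simp add: primitive_root_def)
      then have "finite (torus_stab A)" unfolding R by (rule finite_roots_of_unity)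
      then have "A \<noteq> Amon m \<Gamma>" using infinite_torus_stab_Amon[OF \<Gamma> m, where 'a='a] by auto
      moreover have "\<not> ?\<mu> l \<subseteq> torus_stab A" if "l \<in> ?O" "l \<noteq> n" "n dvd l" for l
        using that roots_of_unity_dvd_iff[OF primO[OF that(1)], of n] unfolding R
        by (auto dest: dvd_antisym)
      ultimately show "?\<mu> n \<subseteq> torus_stab A \<and> A \<noteq> Amon m \<Gamma> \<and>
        (\<forall>l\<in>?O. l \<noteq> n \<and> n dvd l \<longrightarrow> \<not> ?\<mu> l \<subseteq> torus_stab A)" using R by blast
    qed
    finally show ?thesis .
  qed
  show ?thesis
  proof (intro equalityI subsetI)
    fix Z assume Z: "Z \<in> ?L"
    then obtain A where A: "Z = torus_orbit A" "A \<in> AA m \<Gamma>" by (auto simp: quot_def fixed_def)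
    with in_L Z show "Z \<in> ?R" by (metis (mono_tags, lifting) imageI mem_Collect_eq)
  next
    fix Z assume "Z \<in> ?R"
    then obtain A where "Z = torus_orbit A" "A \<in> AA m \<Gamma>" "torus_stab A = ?\<mu> n" by blast
    then show "Z \<in> ?L" using in_L[of A] by simp
  qed
qed

text \<open>The complement is the monomial point together with the fixed sets for l \<noteq> 1: each
  is cut out by vanishing coordinates, and l \<le> m leaves finitely many.\<close>

lemma openin_trivial_stab:
  fixes \<Gamma> :: "nat set"
  assumes \<Gamma>: "\<Gamma> \<in> SS m" and m: "4 \<le> m"
  shows "openin (variety m \<Gamma>) {A \<in> AA m \<Gamma>. torus_stab A = {1 :: 'a::alg_closed_field}}" (is "openin _ ?U")
proof -
  let ?O = "{l \<in> aut_orders TYPE('a) m \<Gamma>. l \<noteq> 1}"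
  let ?F = "\<lambda>l. fixed m \<Gamma> (Cyc l) :: 'a poly set set"
  let ?W = "{Amon m \<Gamma>} \<union> (\<Union>l\<in>?O. ?F l)"
  have prim: "primitive_root l (unity_root l :: 'a)" if "l \<in> ?O" for l
    using that aut_orders_D(1)[OF \<Gamma> m] by blast
  have ne1: "\<not> {c :: 'a. c ^ l = 1} \<subseteq> {1}" if "l \<in> ?O" for l
    using roots_of_unity_dvd_iff[OF prim[OF that], of 1] that by auto
  have Amon_eq: "{Amon m \<Gamma>} = {A :: 'a poly set. A \<in> AA m \<Gamma> \<and>
      (\<forall>\<nu>\<in>ind \<Gamma>. \<forall>j\<in>CC m \<Gamma> \<nu>. True \<longrightarrow> coord m \<Gamma> A \<nu> j = 0)}"
    using eq_Amon_iff[OF \<Gamma> m] Amon_AA[OF \<Gamma> m] by auto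
  have "closedin (variety m \<Gamma>) {Amon m \<Gamma> :: 'a poly set}"
    unfolding Amon_eq by (rule closedin_coord_vanishing)
  moreover have "closedin (variety m \<Gamma>) (?F l)" if "l \<in> ?O" for l
    unfolding fixed_Cyc_eq_coord[OF prim[OF that]] by (rule closedin_coord_vanishing)
  moreover have "finite ?O"
    by (rule finite_subset[of _ "{..m}"]) (use aut_orders_D(2)[OF \<Gamma> m] in auto)
  ultimately have cl: "closedin (variety m \<Gamma>) ?W"
    by (intro closedin_Un closedin_Union) auto
  have "torus_stab A = {1} \<longleftrightarrow> A \<notin> ?W" if A: "A \<in> AA m \<Gamma>" for A :: "'a poly set"
  proof
    assume 1: "torus_stab A = {1}"
    then have "A \<noteq> Amon m \<Gamma>" using infinite_torus_stab_Amon[OF \<Gamma> m, where 'a='a] by auto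
    moreover have "A \<notin> ?F l" if "l \<in> ?O" for l
      using ne1[OF that] 1 unfolding fixed_Cyc_eq[OF prim[OF that]] by simp
    ultimately show "A \<notin> ?W" by blast
  next
    assume n: "A \<notin> ?W"
    then obtain l where l: "l \<in> aut_orders TYPE('a) m \<Gamma>" "torus_stab A = {c. c ^ l = 1}"
      using torus_stab_order[OF \<Gamma> m A] by blast
    have "l = 1"
    proof (rule ccontr)
      assume "l \<noteq> 1"
      then have lO: "l \<in> ?O" using l by simp
      then have "A \<in> ?F l" unfolding fixed_Cyc_eq[OF prim[OF lO]] using A l(2) by simp
      then show False using n lO by blast
    qed
    then show "torus_stab A = {1}" using l by simp
  qed
  then have "?U = topspace (variety m \<Gamma>) - ?W" unfolding topspace_variety by auto
  then show ?thesis using openin_diff[OF openin_topspace cl] by simp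
qed

text \<open>In item 2, n' ranges over all positive integers prime to the characteristic, not only
  over \<open>aut_orders\<close>. In item 4, X consists of orbits, so openness is asserted of its
  union inside the variety.\<close>

theorem corollary4p5:
  fixes m n :: nat and \<Gamma> :: "nat set"
  assumes m: "4 \<le> m" and \<Gamma>: "\<Gamma> \<in> SS m"
    and n: "n \<in> aut_orders TYPE('a::alg_closed_field) m \<Gamma>"
  shows "(primitive_root n (unity_root n :: 'a)
      \<and> fixed m \<Gamma> (Cyc n) \<noteq> ({} :: 'a poly set set)
      \<and> closedin (variety m \<Gamma>) (fixed m \<Gamma> (Cyc n) :: 'a poly set set)
      \<and> fixed m \<Gamma> (Cyc n) = {A :: 'a poly set. A \<in> AA m \<Gamma> \<and>
            (\<forall>\<nu>\<in>ind \<Gamma>. \<forall>j\<in>CC m \<Gamma> \<nu>. \<not> n dvd (j - \<nu>) \<longrightarrow> coord m \<Gamma> A \<nu> j = 0)}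
      \<and> fixed m \<Gamma> (Cyc n) = {A :: 'a poly set. A \<in> AA m \<Gamma> \<and> on_alg (Cyc n) A \<subseteq> Aut A})
     \<and> (quot (fixed m \<Gamma> (Cyc n))
        = {iso_class m \<Gamma> A | A :: 'a poly set. A \<in> AA m \<Gamma> \<and> on_alg (Cyc n) A \<subseteq> Aut A}
      \<and> (\<forall>n'\<ge>1. \<not> CHAR('a) dvd n' \<longrightarrow> n dvd n' \<longrightarrow>
            quot (fixed m \<Gamma> (Cyc n') :: 'a poly set set) \<subseteq> quot (fixed m \<Gamma> (Cyc n))))
     \<and> (quot (fixed m \<Gamma> (Cyc n))
          - ({torus_orbit (Amon m \<Gamma>)}
             \<union> (\<Union>l\<in>{l \<in> aut_orders TYPE('a) m \<Gamma>. l \<noteq> n \<and> n dvd l}. quot (fixed m \<Gamma> (Cyc l))))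
        = {iso_class m \<Gamma> A | A :: 'a poly set. A \<in> AA m \<Gamma> \<and> on_alg (Cyc n) A = Aut A})
     \<and> (let X = quot (AA m \<Gamma>)
          - ({torus_orbit (Amon m \<Gamma>)}
             \<union> (\<Union>l\<in>{l \<in> aut_orders TYPE('a) m \<Gamma>. l \<noteq> 1}. quot (fixed m \<Gamma> (Cyc l))))
      in X = {iso_class m \<Gamma> A | A :: 'a poly set. A \<in> AA m \<Gamma> \<and> Aut A = {restrict id A}}
       \<and> openin (variety m \<Gamma>) (\<Union>X))
     \<and> (fixed m \<Gamma> TT = {Amon m \<Gamma> :: 'a poly set})"
proof -
  let ?\<mu> = "\<lambda>l. {c :: 'a. c ^ l = 1}"
  have m0: "0 < m" using m by simp
  have Amon: "Amon m \<Gamma> \<in> (AA m \<Gamma> :: 'a poly set set)" using \<Gamma> m by (rule Amon_AA)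
  have prim: "primitive_root n (unity_root n :: 'a)" using \<Gamma> m n by (rule aut_orders_D)
  note \<mu>0 = zero_notin_roots_of_unity[OF prim]
  note fix_eq = fixed_Cyc_eq[OF prim, of m \<Gamma>] and fix_coord = fixed_Cyc_eq_coord[OF prim, of m \<Gamma>]
  have sub_iff: "on_alg (Cyc n) A \<subseteq> Aut A \<longleftrightarrow> ?\<mu> n \<subseteq> torus_stab A"
    and eq_iff: "on_alg (Cyc n) A = Aut A \<longleftrightarrow> torus_stab A = ?\<mu> n" if "A \<in> AA m \<Gamma>" for A
    using on_alg_subset_Aut_iff[OF m0 AA_D(1)[OF that] \<mu>0] on_alg_eq_Aut_iff[OF m0 AA_D(1)[OF that] \<mu>0]
    unfolding Cyc_eq[OF prim] by auto
  have "fixed m \<Gamma> (Cyc n) \<noteq> ({} :: 'a poly set set)"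
    using Amon \<mu>0 torus_stab_Amon[OF \<Gamma> m, where 'a='a] unfolding fix_eq by auto
  moreover have "closedin (variety m \<Gamma>) (fixed m \<Gamma> (Cyc n) :: 'a poly set set)"
    unfolding fix_coord by (rule closedin_coord_vanishing)
  moreover have "fixed m \<Gamma> (Cyc n) = {A :: 'a poly set. A \<in> AA m \<Gamma> \<and> on_alg (Cyc n) A \<subseteq> Aut A}"
    unfolding fix_eq using sub_iff by blast
  moreover have "quot (fixed m \<Gamma> (Cyc n))
      = {iso_class m \<Gamma> A | A :: 'a poly set. A \<in> AA m \<Gamma> \<and> on_alg (Cyc n) A \<subseteq> Aut A}"
    unfolding quot_def fix_eq by (rule iso_classes_eq[OF m0 sub_iff, symmetric])
  moreover have "quot (fixed m \<Gamma> (Cyc n') :: 'a poly set set) \<subseteq> quot (fixed m \<Gamma> (Cyc n))"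
    if "1 \<le> n'" "\<not> CHAR('a) dvd n'" "n dvd n'" for n'
    using roots_of_unity_dvd_iff[OF prim, of n'] that(3)
    unfolding quot_def fix_eq fixed_Cyc_eq[OF unity_root_primitive[OF that(1,2)]]
    by (intro image_mono) blast
  moreover have "quot (fixed m \<Gamma> (Cyc n))
        - ({torus_orbit (Amon m \<Gamma>)}
           \<union> (\<Union>l\<in>{l \<in> aut_orders TYPE('a) m \<Gamma>. l \<noteq> n \<and> n dvd l}. quot (fixed m \<Gamma> (Cyc l))))
      = {iso_class m \<Gamma> A | A :: 'a poly set. A \<in> AA m \<Gamma> \<and> on_alg (Cyc n) A = Aut A}"
    unfolding stratum_eq[OF \<Gamma> m prim] by (rule iso_classes_eq[OF m0 eq_iff, symmetric])
  moreover define X where "X = quot (AA m \<Gamma> :: 'a poly set set)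
      - ({torus_orbit (Amon m \<Gamma>)}
         \<union> (\<Union>l\<in>{l \<in> aut_orders TYPE('a) m \<Gamma>. l \<noteq> 1}. quot (fixed m \<Gamma> (Cyc l))))"
  have prim1: "primitive_root 1 (unity_root 1 :: 'a)" by (rule unity_root_primitive) auto
  \<comment> \<open>The trivial group fixes everything, so item 4 is the stratum for n = 1.\<close>
  have "fixed m \<Gamma> (Cyc 1) = (AA m \<Gamma> :: 'a poly set set)"
    unfolding fixed_Cyc_eq[OF prim1] by (auto simp: torus_stab_def)
  then have X: "X = torus_orbit ` {A \<in> AA m \<Gamma>. torus_stab A = {1}}"
    using stratum_eq[OF \<Gamma> m prim1] unfolding X_def by simp
  have triv: "Aut A = {restrict id A} \<longleftrightarrow> torus_stab A = {1}" if "A \<in> AA m \<Gamma>" for A :: "'a poly set"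
  proof -
    have "on_alg (tt ` {1}) A = {restrict id A}" by (simp add: on_alg_def id_def restrict_def)
    then show ?thesis using on_alg_eq_Aut_iff[OF m0 AA_D(1)[OF that], of "{1}"] by auto
  qed
  have "X = {iso_class m \<Gamma> A | A :: 'a poly set. A \<in> AA m \<Gamma> \<and> Aut A = {restrict id A}}"
    unfolding X by (rule iso_classes_eq[OF m0 triv, symmetric])
  moreover have "\<Union>X = {A \<in> AA m \<Gamma>. torus_stab A = {1}}"
  proof (intro equalityI subsetI)
    fix B assume "B \<in> \<Union>X"
    then obtain A c where "A \<in> AA m \<Gamma>" "torus_stab A = {1}" "c \<noteq> 0" "B = tt c ` A"
      by (auto simp: X torus_orbit_eq)
    then show "B \<in> {A \<in> AA m \<Gamma>. torus_stab A = {1}}" by (simp add: tt_AA torus_stab_tt)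
  qed (use torus_orbit_refl X in blast)
  then have "openin (variety m \<Gamma>) (\<Union>X)" using openin_trivial_stab[OF \<Gamma> m, where 'a='a] by simp
  moreover have "fixed m \<Gamma> TT = {Amon m \<Gamma> :: 'a poly set}"
  proof (intro equalityI subsetI)
    fix A :: "'a poly set" assume "A \<in> fixed m \<Gamma> TT"
    then have A: "A \<in> AA m \<Gamma>" and "torus_stab A = torus_stab (Amon m \<Gamma>)"
      unfolding torus_stab_Amon[OF \<Gamma> m] by (auto simp: fixed_def TT_def torus_stab_def)
    \<comment> \<open>An infinite stabiliser cannot consist of roots of unity of a fixed order,
      which leaves only the monomial algebra.\<close>
    then have inf: "infinite (torus_stab A)" using infinite_torus_stab_Amon[OF \<Gamma> m] by simp
    have "A = Amon m \<Gamma>"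
    proof (rule ccontr)
      assume "A \<noteq> Amon m \<Gamma>"
      then obtain l where l: "1 \<le> l" "torus_stab A = {c. c ^ l = 1}"
        using torus_stab_roots_of_unity[OF \<Gamma> m A] by blast
      from finite_roots_of_unity(1)[OF l(1), where 'a='a] show False using inf l(2) by simp
    qed
    then show "A \<in> {Amon m \<Gamma>}" by simp
  next
    fix A :: "'a poly set" assume "A \<in> {Amon m \<Gamma>}"
    then show "A \<in> fixed m \<Gamma> TT"
      using Amon torus_stab_Amon[OF \<Gamma> m, where 'a='a] by (auto simp: fixed_def TT_def torus_stab_def)
  qed
  ultimately show ?thesis
    unfolding Let_def X_def[symmetric] using prim fix_coord by blast
qed

end
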